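(* Let $\xi$ be a real number which is neither rational nor quadratic. If $\beta_0(\xi)<\sqrt3$, then $\widehat{\lambda}_2(\xi)=\widehat{\lambda}_{\min}(\xi)=1/\beta_0(\xi)$.
   Context: $\|\cdot\|$ is the maximum norm on $\mathbb{R}^3$ and $\wedge$ the cross product. For $\xi\in\mathbb{R}$ neither rational nor quadratic, put $\Xi=(1,\xi,\xi^2)$. $\lambda_2(\xi)$ (resp. $\widehat{\lambda}_2(\xi)$) is the supremum of the real $\lambda$ such that for arbitrarily large $X$ (resp. for all sufficiently large $X$) there is $x\in\mathbb{Z}^3\setminus\{0\}$ with $\|x\wedge\Xi\|\le X^{-\lambda}$ and $\|x\|\le X$. For $0\le\mu<\lambda_2(\xi)$, $\widehat{\lambda}_\mu(\Xi)$ is the supremum of the real $\lambda$ such that for all sufficiently large $X$ there is $x\in\mathbb{Z}^3\setminus\{0\}$ with $\|x\wedge\Xi\|\le\min(X^{-\lambda},\|x\|^{-\mu})$ and $\|x\|\le X$; the map $\mu\mapsto\widehat{\lambda}_\mu(\Xi)$ is non-increasing. Then $$\beta_0(\xi):=\begin{cases}\lim_{\mu\to1^-}1/\widehat{\lambda}_\mu(\Xi)&\text{if }\lambda_2(\xi)\ge1,\\ \infty&\text{otherwise,}\end{cases}\qquad \widehat{\lambda}_{\min}(\xi):=\lim_{\mu\to\lambda_2(\xi)^-}\widehat{\lambda}_\mu(\Xi).$$ *)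

theory Defs
  imports "HOL-Analysis.Analysis" "HOL-Computational_Algebra.Computational_Algebra"
begin

definition quadratic_number :: "real \<Rightarrow> bool" where
  "quadratic_number \<xi> \<longleftrightarrow>
     (\<exists>p :: rat poly. irreducible p \<and> degree p = 2 \<and> poly (map_poly of_rat p) \<xi> = 0)"

definition Xi_point :: "real \<Rightarrow> real ^ 3" where
  "Xi_point \<xi> = vector [1, \<xi>, \<xi>\<^sup>2]"

definition int_points :: "(real ^ 3) set" where
  "int_points = {x. x \<noteq> 0 \<and> (\<forall>i. x $ i \<in> \<int>)}"

text \<open>The maximum norm is \<open>infnorm\<close>. The suprema are taken in the extended reals, since
  \<open>lambda2 \<xi>\<close> is infinite for some \<open>\<xi>\<close> (for instance for Liouville numbers).\<close>

definition lambda2 :: "real \<Rightarrow> ereal" where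
  "lambda2 \<xi> = Sup (ereal ` {l :: real. \<exists>\<^sub>F X :: real in at_top.
     \<exists>x \<in> int_points. infnorm (cross3 x (Xi_point \<xi>)) \<le> X powr (- l) \<and> infnorm x \<le> X})"

definition lambda2_hat :: "real \<Rightarrow> ereal" where
  "lambda2_hat \<xi> = Sup (ereal ` {l :: real. \<forall>\<^sub>F X :: real in at_top.
     \<exists>x \<in> int_points. infnorm (cross3 x (Xi_point \<xi>)) \<le> X powr (- l) \<and> infnorm x \<le> X})"

text \<open>The next notion is only meaningful for \<open>0 \<le> \<mu> < lambda2 \<xi>\<close>, where \<open>p = Xi_point \<xi>\<close>; the
  limits below only involve such \<open>\<mu>\<close>.\<close>

definition lambda_hat_mu :: "real \<Rightarrow> real ^ 3 \<Rightarrow> ereal" where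
  "lambda_hat_mu \<mu> p = Sup (ereal ` {l :: real. \<forall>\<^sub>F X :: real in at_top.
     \<exists>x \<in> int_points. infnorm (cross3 x p) \<le> min (X powr (- l)) (infnorm x powr (- \<mu>))
       \<and> infnorm x \<le> X})"

text \<open>Both limits exist in the extended reals because \<open>\<mu> \<mapsto> lambda_hat_mu \<mu> (Xi_point \<xi>)\<close> is
  non-increasing and non-negative on the relevant range; in \<^typ>\<open>ereal\<close>, \<open>1 / 0 = \<infinity>\<close>.\<close>

definition beta0 :: "real \<Rightarrow> ereal" where
  "beta0 \<xi> = (if lambda2 \<xi> \<ge> 1
     then Lim (at_left (1 :: real)) (\<lambda>\<mu>. 1 / lambda_hat_mu \<mu> (Xi_point \<xi>))
     else \<infinity>)"

text \<open>Here \<open>\<mu>\<close> ranges over \<^typ>\<open>ereal\<close> so that the case \<open>lambda2 \<xi> = \<infinity>\<close>, in which \<open>\<mu>\<close> tends to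
  infinity, is included.\<close>

definition lambda_hat_min :: "real \<Rightarrow> ereal" where
  "lambda_hat_min \<xi> =
     Lim (at_left (lambda2 \<xi>)) (\<lambda>\<mu>. lambda_hat_mu (real_of_ereal \<mu>) (Xi_point \<xi>))"

end

theory Submission
  imports Defs
begin

text \<open>
For an integer point \<open>x\<close> write \<open>N x\<close> for its norm and \<open>L x\<close> for the norm of \<open>x \<and> \<Xi>\<close>. Call \<open>x\<close>
good, at level \<open>e\<close>, if \<open>L x \<le> N x powr (-(1 - e))\<close>. The hypothesis on \<open>\<beta>\<^sub>0\<close> says that \<open>\<lambda>\<^sub>2 \<ge> 1\<close> and that
there is one \<open>\<nu> > 1 / sqrt 3\<close> such that, for every \<open>e > 0\<close>, already the good points of level \<open>e\<close>
realise the uniform exponent \<open>\<nu>\<close>. The heart of the matter is that for every \<open>\<mu> < 1\<close> the points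
with \<open>L x \<le> N x powr (-\<mu>)\<close> then approximate, uniformly, as well as all integer points do:
\<open>lambda_hat_mu \<mu> \<Xi> = lambda2_hat \<xi>\<close> (lemma \<open>uniform_transfer\<close>). Moreover \<open>\<lambda>\<^sub>2 = 1\<close>: a point with \<open>L x\<close> far below \<open>1 / N x\<close>
has determinant \<open>x\<^sub>1 x\<^sub>3 - x\<^sub>2\<^sup>2\<close> zero, so is a multiple of some \<open>(b\<^sup>2, a b, a\<^sup>2)\<close>, and such a point
leaves a gap that the uniform exponent \<open>\<nu> > 1/2\<close> excludes (\<open>qdet_nonzero\<close>, \<open>no_better_than_1\<close>).
Both limits in the definitions are then limits at \<open>1\<close> of an eventually constant function.

To compare all points with the good ones, use the logarithms \<open>h x\<close> and \<open>l x\<close> of \<open>N x\<close> and \<open>L x\<close>.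
The good points have \<open>l x\<close> very close to \<open>- h x\<close>, and they are rigid. An integer
vector \<open>a\<close> orthogonal to a good point \<open>v\<close> satisfies \<open>h a \<ge> (2 - s) h v\<close>, with \<open>s\<close> slightly below
\<open>sqrt 3\<close>; otherwise all later good points would lie in the same plane, and \<open>\<Xi>\<close> with them
(\<open>plane_height\<close>). Applied to \<open>a = u \<and> v\<close> this shows that the logarithmic sizes of two
independent good points differ by a factor of at least \<open>1 / (s - 1)\<close>, while consecutive points
of a suitable chain \<open>x\<^sub>0, x\<^sub>1, \<dots>\<close> differ by a factor of at most \<open>s\<close>. As \<open>s (s - 1)\<^sup>2 < 1\<close>, every
good point is proportional to a member of the chain (\<open>proportional_member\<close>).

Now read points as symmetric \<open>2 \<times> 2\<close> matrices. The product \<open>x adj(y) z\<close>, when it is symmetric, of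
suitable good points is again good, hence proportional to a member of the chain. With
\<open>n\<^sub>j = h x\<^sub>j\<close>, the point \<open>x\<^sub>j adj(x\<^sub>j\<^sub>+\<^sub>1) x\<^sub>j\<close> has size \<open>2 n\<^sub>j - n\<^sub>j\<^sub>+\<^sub>1\<close> and lies in the span of \<open>x\<^sub>j\<close> and
\<open>x\<^sub>j\<^sub>+\<^sub>1\<close>. Comparing sizes identifies which member of the chain it is; this is where \<open>s\<^sup>2 < 3\<close> is used
in full strength (\<open>growth_contradiction_1\<close>, \<open>growth_contradiction_2\<close>). The outcome is a recurrence
which shows that the determinant of three consecutive members, when it is not zero, is
essentially that of three earlier consecutive members (\<open>Delta_recurrence\<close>). Hence these
determinants are bounded by small powers of \<open>N x\<^sub>j\<close> (\<open>Delta_bound\<close>), which means that \<open>x\<^sub>j\<close> and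
\<open>x\<^sub>j\<^sub>+\<^sub>1\<close> generate a subgroup of small index in the integer points of their plane.

Finally let \<open>y\<close> have size below that of \<open>x\<^sub>j\<^sub>+\<^sub>1\<close>, and let \<open>L y\<close> be smaller than \<open>L x\<^sub>j\<close> by a small
power. Then \<open>y\<close> lies in that plane, and as the index is small its coordinate along
\<open>x\<^sub>j\<close> must vanish. So \<open>y\<close> is proportional to \<open>x\<^sub>j\<^sub>+\<^sub>1\<close> and is good itself
(\<open>small_point_is_member\<close>). Therefore a good point can always replace an arbitrary one, at the
cost of an arbitrarily small loss in the exponent.
\<close>

(* The components of a vector and the coefficients of a formal power series share the infix
   symbol; with both active, the number of parse trees of a formula doubles with every use. *)
no_notation fps_nth (infixl "$" 75)

section \<open>Integer points as symmetric matrices\<close>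

text \<open>A point \<open>x\<close> is read as the symmetric matrix with rows \<open>(x\<^sub>1, x\<^sub>2)\<close> and \<open>(x\<^sub>2, x\<^sub>3)\<close>, which is
close to a multiple of the rank one matrix \<open>v v\<^sup>T\<close>, \<open>v = (1, \<xi>)\<close>, when \<open>x\<close> is close to the line
through \<open>\<Xi>\<close>.\<close>

definition qdet :: "real ^ 3 \<Rightarrow> real" where
  "qdet x = x $ 1 * x $ 3 - (x $ 2)\<^sup>2"

definition det3 :: "real ^ 3 \<Rightarrow> real ^ 3 \<Rightarrow> real ^ 3 \<Rightarrow> real" where
  "det3 x y z = x \<bullet> cross3 y z"

text \<open>The first row and the lower right entry of the matrix product \<open>x adj(y) z\<close>.\<close>

definition sandwich :: "real ^ 3 \<Rightarrow> real ^ 3 \<Rightarrow> real ^ 3 \<Rightarrow> real ^ 3" where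
  "sandwich x y z = vector
     [(x$1 * y$3 - x$2 * y$2) * z$1 + (x$2 * y$1 - x$1 * y$2) * z$2,
      (x$1 * y$3 - x$2 * y$2) * z$2 + (x$2 * y$1 - x$1 * y$2) * z$3,
      (x$2 * y$3 - x$3 * y$2) * z$2 + (x$3 * y$1 - x$2 * y$2) * z$3]"

lemma det3_expand:
  "det3 x y z = x$1 * (y$2 * z$3 - y$3 * z$2) + x$2 * (y$3 * z$1 - y$1 * z$3)
     + x$3 * (y$1 * z$2 - y$2 * z$1)"
  by (simp add: det3_def cross3_def inner_vec_def sum_3)

lemma det3_rotate: "det3 x y z = det3 y z x"
  by (simp add: det3_expand algebra_simps)

lemma det3_swap: "det3 x y z = - det3 x z y"
  by (simp add: det3_expand algebra_simps)

lemma det3_repeat [simp]: "det3 x x y = 0" "det3 x y x = 0" "det3 y x x = 0"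
  by (simp_all add: det3_expand algebra_simps)

text \<open>The antisymmetric part of \<open>x adj(y) z\<close> is \<open>det3 x y z\<close> up to sign. So the hypothesis makes the
product symmetric, and \<open>qdet\<close> becomes multiplicative.\<close>

lemma qdet_sandwich:
  assumes "det3 x y z = 0"
  shows "qdet (sandwich x y z) = qdet x * qdet y * qdet z"
proof -
  have *: "((a * p - b * q) * u + (b * r - a * q) * v) * ((b * p - c * q) * v + (c * r - b * q) * w)
      - ((a * p - b * q) * v + (b * r - a * q) * w) * ((b * p - c * q) * u + (c * r - b * q) * v)
      = (a * c - b\<^sup>2) * (r * p - q\<^sup>2) * (u * w - v\<^sup>2)" for a b c p q r u v w :: real
    by algebra
  have "(sandwich x y z) $ 2 =
      (x$2 * y$3 - x$3 * y$2) * z$1 + (x$3 * y$1 - x$2 * y$2) * z$2" (is "_ = ?c")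
    using assms by (simp add: sandwich_def det3_expand algebra_simps)
  then have "qdet (sandwich x y z)
      = (sandwich x y z) $ 1 * (sandwich x y z) $ 3 - (sandwich x y z) $ 2 * ?c"
    by (simp add: qdet_def power2_eq_square)
  also have "\<dots> = qdet x * qdet y * qdet z"
    unfolding sandwich_def vector_3 qdet_def by (rule *)
  finally show ?thesis .
qed

text \<open>The Cayley--Hamilton identity for the matrix \<open>x adj(y)\<close>, multiplied by \<open>x\<close>.\<close>

lemma sandwich_self:
  "sandwich x y x = (x$1 * y$3 - 2 * x$2 * y$2 + x$3 * y$1) *\<^sub>R x - qdet x *\<^sub>R y"
  by (simp add: vec_eq_iff forall_3 sandwich_def qdet_def algebra_simps power2_eq_square)

lemma det3_sandwich_self: "det3 g x (sandwich x y x) = - qdet x * det3 g x y"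
  by (simp add: sandwich_self det3_expand algebra_simps)

lemma int_points_D: "x \<in> int_points \<Longrightarrow> x $ i \<in> \<int>"
  by (simp add: int_points_def)

lemma det3_Ints: "\<lbrakk>x \<in> int_points; y \<in> int_points; z \<in> int_points\<rbrakk> \<Longrightarrow> det3 x y z \<in> \<int>"
  by (auto simp: det3_expand int_points_def)

lemma qdet_Ints: "x \<in> int_points \<Longrightarrow> qdet x \<in> \<int>"
  by (auto simp: qdet_def int_points_def)

lemma sandwich_int_points:
  assumes "x \<in> int_points" "y \<in> int_points" "z \<in> int_points"
    and "det3 x y z = 0" "qdet x \<noteq> 0" "qdet y \<noteq> 0" "qdet z \<noteq> 0"
  shows "sandwich x y z \<in> int_points"
proof -
  have "qdet (sandwich x y z) \<noteq> 0"
    using assms by (simp add: qdet_sandwich)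
  then have "sandwich x y z \<noteq> 0"
    by (auto simp: qdet_def)
  moreover have "\<forall>i. sandwich x y z $ i \<in> \<int>"
    using assms(1-3) by (auto simp: forall_3 sandwich_def int_points_def)
  ultimately show ?thesis
    by (simp add: int_points_def)
qed

lemma infnorm_3_leI:
  assumes "\<bar>x$1\<bar> \<le> b" "\<bar>x$2\<bar> \<le> b" "\<bar>x$3\<bar> \<le> b"
  shows "infnorm (x :: real ^ 3) \<le> b"
  unfolding infnorm_cart using assms by (intro cSup_least) (auto, metis exhaust_3)

lemma infnorm_int_points_ge_1:
  assumes "x \<in> int_points" shows "1 \<le> infnorm x"
proof -
  obtain i where "x $ i \<noteq> 0"
    using assms by (auto simp: int_points_def vec_eq_iff)
  then have "1 \<le> \<bar>x $ i\<bar>"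
    using assms by (intro Ints_nonzero_abs_ge1) (auto simp: int_points_def)
  also have "\<dots> \<le> infnorm x"
    by (rule component_le_infnorm_cart)
  finally show ?thesis .
qed

lemma cross3_int_points:
  assumes "x \<in> int_points" "y \<in> int_points" "cross3 x y \<noteq> 0"
  shows "cross3 x y \<in> int_points"
  using assms by (auto simp: int_points_def cross3_def forall_3)

definition err :: "real \<Rightarrow> real ^ 3 \<Rightarrow> real" where
  "err \<xi> x = infnorm (cross3 x (Xi_point \<xi>))"

text \<open>The constant \<open>k\<close> is kept opaque: expanded powers of \<open>1 + \<bar>\<xi>\<bar>\<close> would swamp the arithmetic. All
implied constants below are numerical multiples of powers of \<open>k\<close>.\<close>

locale point_bounds =
  fixes \<xi> k :: real
  assumes k_def: "k = 1 + \<bar>\<xi>\<bar>"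
begin

lemma k_ge_1: "1 \<le> k" and k_nonneg [simp]: "0 \<le> k"
  by (simp_all add: k_def)

text \<open>The bounds are easiest in terms of these two linear forms, which express \<open>x\<close> as \<open>x\<^sub>1 \<Xi>\<close> plus a
small error.\<close>

abbreviation "U1 x \<equiv> x $ 2 - \<xi> * (x :: real ^ 3) $ 1"
abbreviation "U2 x \<equiv> x $ 3 - \<xi> * (x :: real ^ 3) $ 2"
abbreviation "L \<equiv> err \<xi>"

lemma err_nonneg: "0 \<le> L x"
  by (simp add: err_def infnorm_pos_le)

lemma cross_Xi: "cross3 x (Xi_point \<xi>) = vector [- \<xi> * U2 x, U2 x + \<xi> * U1 x, - U1 x]"
  by (simp add: cross3_def Xi_point_def vec_eq_iff forall_3 algebra_simps power2_eq_square)

lemma U1_le: "\<bar>U1 x\<bar> \<le> k * L x" and U2_le: "\<bar>U2 x\<bar> \<le> k * L x"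
proof -
  have a: "\<bar>U1 x\<bar> \<le> L x"
    using component_le_infnorm_cart[of "cross3 x (Xi_point \<xi>)" 3]
    by (simp add: cross_Xi err_def abs_minus_commute)
  have b: "\<bar>U2 x + \<xi> * U1 x\<bar> \<le> L x"
    using component_le_infnorm_cart[of "cross3 x (Xi_point \<xi>)" 2]
    by (simp add: cross_Xi err_def)
  have c: "\<bar>\<xi> * U1 x\<bar> \<le> \<bar>\<xi>\<bar> * L x"
    using a by (simp add: abs_mult mult_left_mono)
  have 0: "0 \<le> \<bar>\<xi>\<bar> * L x" by (simp add: err_nonneg)
  show "\<bar>U1 x\<bar> \<le> k * L x" using a 0 unfolding k_def distrib_right by linarith
  show "\<bar>U2 x\<bar> \<le> k * L x" using b c unfolding k_def distrib_right by linarith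
qed

lemma err_le_U:
  assumes "\<bar>U1 x\<bar> \<le> b" "\<bar>U2 x\<bar> \<le> b" shows "L x \<le> k * b"
proof -
  have 0: "0 \<le> b" "0 \<le> \<bar>\<xi>\<bar> * b" using assms by auto
  have "\<bar>\<xi> * U2 x\<bar> \<le> \<bar>\<xi>\<bar> * b" "\<bar>\<xi> * U1 x\<bar> \<le> \<bar>\<xi>\<bar> * b"
    using assms by (simp_all add: abs_mult mult_left_mono)
  then show ?thesis
    unfolding err_def cross_Xi
    by (intro infnorm_3_leI) (use assms 0 in \<open>auto simp: k_def algebra_simps\<close>)
qed

lemma err_le_infnorm: "L x \<le> k\<^sup>2 * infnorm x"
proof -
  have a: "\<bar>x $ i\<bar> \<le> infnorm x" for i by (rule component_le_infnorm_cart)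
  have "\<bar>\<xi> * x $ i\<bar> \<le> \<bar>\<xi>\<bar> * infnorm x" for i using a by (simp add: abs_mult mult_left_mono)
  then have "\<bar>x $ j - \<xi> * x $ i\<bar> \<le> k * infnorm x" for i j
    using a[of j] abs_triangle_ineq4[of "x $ j" "\<xi> * x $ i"] unfolding k_def distrib_right
    by (metis (no_types, lifting) add_mono mult_1 order_trans)
  then have "L x \<le> k * (k * infnorm x)"
    by (intro err_le_U)
  then show ?thesis by (simp add: power2_eq_square)
qed

lemma infnorm_le_first: "infnorm x \<le> k^3 * (\<bar>x$1\<bar> + L x)"
proof -
  let ?b = "\<bar>x$1\<bar> + L x"
  have b: "0 \<le> ?b" "\<bar>x$1\<bar> \<le> ?b" by (simp_all add: err_nonneg)
  have k: "1 \<le> k" by (rule k_ge_1)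
  have "\<bar>\<xi> * x$1\<bar> \<le> k * \<bar>x$1\<bar>"
    by (simp add: abs_mult mult_right_mono k_def)
  then have x2: "\<bar>x$2\<bar> \<le> k * ?b"
    using U1_le[of x] by (simp add: distrib_left)
  have k2: "k * \<bar>\<xi>\<bar> * ?b + k * ?b = k\<^sup>2 * ?b"
    by (simp add: k_def power2_eq_square algebra_simps)
  have "\<bar>\<xi> * x$2\<bar> \<le> k * \<bar>\<xi>\<bar> * ?b"
    using x2 mult_left_mono[OF x2, of "\<bar>\<xi>\<bar>"] by (simp add: abs_mult mult.assoc mult.left_commute)
  moreover have "k * L x \<le> k * ?b" by (rule mult_left_mono) auto
  ultimately have x3: "\<bar>x$3\<bar> \<le> k\<^sup>2 * ?b"
    using U2_le[of x] k2 by linarith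
  have "k ^ i * ?b \<le> k^3 * ?b" if "i \<le> 3" for i
    using b that k by (intro mult_right_mono power_increasing) auto
  from this[of 0] this[of 1] this[of 2] show ?thesis
    using b x2 x3 by (intro infnorm_3_leI) auto
qed

lemma abs_mult_le: "\<bar>a * b\<bar> \<le> A * B" if "\<bar>a\<bar> \<le> A" "\<bar>b\<bar> \<le> B" for a b A B :: real
  using that by (auto simp: abs_mult intro!: mult_mono)

lemma abs_add_le: "\<bar>a + b\<bar> \<le> A + B" if "\<bar>a\<bar> \<le> A" "\<bar>b\<bar> \<le> B" for a b A B :: real
  using that by linarith

lemma abs_minor_le:
  assumes "\<bar>a\<bar> \<le> X" "\<bar>b\<bar> \<le> Y" "\<bar>u\<bar> \<le> P" "\<bar>v\<bar> \<le> Q"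
  shows "\<bar>a * v - b * u\<bar> \<le> X * Q + Y * (P :: real)"
  using abs_add_le[OF abs_mult_le[OF assms(1,4)], of "- (b * u)"] abs_mult_le[OF assms(2,3)] by simp

lemma abs_minor_minus: "\<bar>a * b\<bar> \<le> c \<Longrightarrow> \<bar>a * - b\<bar> \<le> c" for a b c :: real
  by simp

lemma qdet_bound: "\<bar>qdet x\<bar> \<le> 2 * k * (infnorm x * L x)"
proof -
  have e: "qdet x = x$1 * U2 x - x$2 * U1 x"
    by (simp add: qdet_def algebra_simps power2_eq_square)
  have "\<bar>qdet x\<bar> \<le> infnorm x * (k * L x) + infnorm x * (k * L x)"
    unfolding e by (intro abs_minor_le component_le_infnorm_cart U1_le U2_le)
  then show ?thesis by (simp add: algebra_simps)
qed

text \<open>Subtracting multiples of the columns replaces the second and third coordinates by the small forms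
\<open>U1\<close> and \<open>U2\<close>.\<close>

lemma det3_bound:
  "\<bar>det3 x y z\<bar> \<le> 2 * k\<^sup>2 *
     (infnorm x * L y * L z + infnorm y * L x * L z + infnorm z * L x * L y)"
proof -
  have *: "\<bar>a$1 * (U1 b * U2 c - U2 b * U1 c)\<bar> \<le> infnorm a * (2 * (k * L b) * (k * L c))"
    for a b c :: "real ^ 3"
  proof -
    have "\<bar>U1 b * U2 c - U2 b * U1 c\<bar> \<le> (k * L b) * (k * L c) + (k * L b) * (k * L c)"
      by (intro abs_minor_le U1_le U2_le)
    then show ?thesis
      by (intro abs_mult_le component_le_infnorm_cart) (simp add: mult_ac)
  qed
  have e: "det3 x y z = x$1 * (U1 y * U2 z - U2 y * U1 z) + y$1 * (U1 z * U2 x - U2 z * U1 x)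
     + z$1 * (U1 x * U2 y - U2 x * U1 y)"
    by (simp add: det3_expand algebra_simps)
  have "\<bar>det3 x y z\<bar> \<le> infnorm x * (2 * (k * L y) * (k * L z))
       + infnorm y * (2 * (k * L z) * (k * L x)) + infnorm z * (2 * (k * L x) * (k * L y))"
    unfolding e by (intro abs_add_le *)
  also have "\<dots> = 2 * k\<^sup>2 *
     (infnorm x * L y * L z + infnorm y * L x * L z + infnorm z * L x * L y)"
    by algebra
  finally show ?thesis .
qed

lemma cross3_bound: "infnorm (cross3 x y) \<le> k\<^sup>2 * (infnorm x * L y + infnorm y * L x)"
proof -
  have k: "k \<le> k\<^sup>2" using k_ge_1 by (simp add: self_le_power)
  have n: "0 \<le> infnorm x * L y + infnorm y * L x"
    by (simp add: err_nonneg infnorm_pos_le)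
  have U: "\<bar>U2 w + \<xi> * U1 w\<bar> \<le> k\<^sup>2 * L w" for w
  proof -
    have "\<bar>\<xi> * U1 w\<bar> \<le> \<bar>\<xi>\<bar> * (k * L w)" by (intro abs_mult_le U1_le) simp
    then show ?thesis using U2_le[of w] by (simp add: k_def power2_eq_square algebra_simps)
  qed
  have le: "k * (infnorm x * L y + infnorm y * L x) \<le> k\<^sup>2 * (infnorm x * L y + infnorm y * L x)"
    using k n by (rule mult_right_mono)
  have 1: "\<bar>x$2 * U2 y - y$2 * U2 x\<bar> \<le> infnorm x * (k * L y) + infnorm y * (k * L x)"
    by (intro abs_minor_le component_le_infnorm_cart U2_le)
  have 2: "\<bar>x$1 * (U2 y + \<xi> * U1 y) - y$1 * (U2 x + \<xi> * U1 x)\<bar>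
      \<le> infnorm x * (k\<^sup>2 * L y) + infnorm y * (k\<^sup>2 * L x)"
    by (intro abs_minor_le component_le_infnorm_cart U)
  have 3: "\<bar>x$1 * U1 y - y$1 * U1 x\<bar> \<le> infnorm x * (k * L y) + infnorm y * (k * L x)"
    by (intro abs_minor_le component_le_infnorm_cart U1_le)
  have "(cross3 x y)$1 = x$2 * U2 y - y$2 * U2 x"
    "(cross3 x y)$2 = - (x$1 * (U2 y + \<xi> * U1 y) - y$1 * (U2 x + \<xi> * U1 x))"
    "(cross3 x y)$3 = x$1 * U1 y - y$1 * U1 x"
    by (simp_all add: cross3_def algebra_simps)
  with 1 2 3 le show ?thesis
    by (intro infnorm_3_leI) (simp_all add: algebra_simps)
qed

text \<open>The product \<open>x adj(y)\<close> loses its main term because \<open>v\<^sup>T adj(v v\<^sup>T) = 0\<close>, and the remaining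
factor \<open>z\<close> is applied to the vector \<open>(-\<xi>, 1)\<close>, which contributes \<open>L z\<close>.\<close>

lemma err_sandwich:
  assumes "det3 x y z = 0"
  shows "L (sandwich x y z) \<le> 2 * k^4 * (L z * (infnorm y * L x + infnorm x * L y))"
proof -
  let ?q = "infnorm y * (k * L x) + infnorm x * (k * L y)"
  let ?T = "sandwich x y z"
  have a1: "\<bar>x$i * U2 y - y$2 * u\<bar> \<le> ?q" if "\<bar>u\<bar> \<le> k * L x" for i u
    by (subst add.commute) (intro abs_minor_le component_le_infnorm_cart that U2_le)
  have a2: "\<bar>y$1 * u - x$i * U1 y\<bar> \<le> ?q" if "\<bar>u\<bar> \<le> k * L x" for i u
    by (intro abs_minor_le component_le_infnorm_cart that U1_le)
  have s: "?T$2 = (x$2 * y$3 - x$3 * y$2) * z$1 + (x$3 * y$1 - x$2 * y$2) * z$2"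
    using assms by (simp add: sandwich_def det3_expand algebra_simps)
  have e1: "U1 ?T = (x$1 * U2 y - y$2 * U1 x) * U1 z + (y$1 * U1 x - x$1 * U1 y) * U2 z"
    by (simp add: sandwich_def algebra_simps)
  have e2: "U2 ?T = (x$2 * U2 y - y$2 * U2 x) * U1 z + (y$1 * U2 x - x$2 * U1 y) * U2 z"
    unfolding s by (simp add: sandwich_def algebra_simps)
  have b1: "\<bar>U1 ?T\<bar> \<le> ?q * (k * L z) + ?q * (k * L z)"
    unfolding e1 by (intro abs_add_le abs_mult_le a1 a2 U1_le U2_le)
  have b2: "\<bar>U2 ?T\<bar> \<le> ?q * (k * L z) + ?q * (k * L z)"
    unfolding e2 by (intro abs_add_le abs_mult_le a1 a2 U1_le U2_le)
  have "L ?T \<le> k * (?q * (k * L z) + ?q * (k * L z))"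
    by (rule err_le_U[OF b1 b2])
  also have "\<dots> = 2 * k^3 * (L z * (infnorm y * L x + infnorm x * L y))"
    by (simp add: power3_eq_cube algebra_simps)
  also have "\<dots> \<le> 2 * k^4 * (L z * (infnorm y * L x + infnorm x * L y))"
    by (intro mult_right_mono mult_left_mono power_increasing)
      (auto simp: err_nonneg infnorm_pos_le k_ge_1)
  finally show ?thesis .
qed

lemma infnorm_sandwich:
  assumes "det3 x y z = 0"
  shows "infnorm (sandwich x y z)
    \<le> 10 * k^9 * (infnorm y * L x * L z + infnorm x * infnorm z * L y)"
proof -
  let ?T = "sandwich x y z"
  let ?p = "infnorm y * L x * L z" and ?q = "infnorm x * infnorm z * L y"
  have pq: "0 \<le> ?p" "0 \<le> ?q" by (simp_all add: err_nonneg infnorm_pos_le)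
  note c = component_le_infnorm_cart
  have e1: "?T$1 = x$1 * (U2 y * z$1 - U1 y * z$2) + U1 x * (y$1 * U1 z - z$1 * U1 y)"
    by (simp add: sandwich_def algebra_simps)
  have "\<bar>z$1 * U2 y - z$2 * U1 y\<bar> \<le> infnorm z * (k * L y) + infnorm z * (k * L y)"
    by (intro abs_minor_le c U1_le U2_le)
  then have "\<bar>x$1 * (U2 y * z$1 - U1 y * z$2)\<bar> \<le> infnorm x * (infnorm z * (k * L y) + infnorm z * (k * L y))"
    by (intro abs_mult_le c) (simp add: mult.commute)
  then have t1: "\<bar>x$1 * (U2 y * z$1 - U1 y * z$2)\<bar> \<le> 2 * k * ?q"
    by (simp add: algebra_simps)
  have "\<bar>y$1 * U1 z - z$1 * U1 y\<bar> \<le> infnorm y * (k * L z) + infnorm z * (k * L y)"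
    by (intro abs_minor_le c U1_le)
  then have "\<bar>U1 x * (y$1 * U1 z - z$1 * U1 y)\<bar> \<le> (k * L x) * (infnorm y * (k * L z) + infnorm z * (k * L y))"
    by (intro abs_mult_le U1_le)
  also have "\<dots> = k^2 * ?p + k^2 * (L x * (infnorm z * L y))"
    by (simp add: power2_eq_square algebra_simps)
  also have "\<dots> \<le> k^2 * ?p + k^2 * ((k\<^sup>2 * infnorm x) * (infnorm z * L y))"
    by (intro add_left_mono mult_left_mono mult_right_mono err_le_infnorm)
      (auto simp: err_nonneg infnorm_pos_le)
  finally have t2: "\<bar>U1 x * (y$1 * U1 z - z$1 * U1 y)\<bar> \<le> k^2 * ?p + k^4 * ?q"
    by (simp add: algebra_simps power2_eq_square power4_eq_xxxx)
  have pw: "k^i * ?p \<le> k^6 * ?p" "k^i * ?q \<le> k^6 * ?q" if "i \<le> 6" for i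
    using that pq k_ge_1 by (auto intro!: mult_right_mono power_increasing)
  have T1: "\<bar>?T$1\<bar> \<le> 3 * (k^6 * ?p) + 3 * (k^6 * ?q)"
  proof -
    have q1: "k * ?q \<le> k^6 * ?q" using pw(2)[of 1] by simp
    have p6: "0 \<le> k^6 * ?p" using pq by simp
    have "\<bar>?T$1\<bar> \<le> 2 * k * ?q + (k^2 * ?p + k^4 * ?q)"
      unfolding e1 by (intro abs_add_le t1 t2)
    moreover note q1 pw(1)[of 2] pw(2)[of 4] p6
    ultimately show ?thesis by simp
  qed
  have "L ?T \<le> 2 * k^4 * (?p + L z * (infnorm x * L y))"
    using err_sandwich[OF assms] by (simp add: algebra_simps)
  also have "\<dots> \<le> 2 * k^4 * (?p + (k\<^sup>2 * infnorm z) * (infnorm x * L y))"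
    by (intro add_left_mono mult_left_mono mult_right_mono err_le_infnorm)
      (auto simp: err_nonneg infnorm_pos_le)
  also have "\<dots> = 2 * (k^4 * ?p) + 2 * (k^6 * ?q)"
    by (simp add: algebra_simps power2_eq_square eval_nat_numeral)
  finally have T2: "L ?T \<le> 2 * (k^6 * ?p) + 2 * (k^6 * ?q)"
    using pw(1)[of 4] by linarith
  have "infnorm ?T \<le> k^3 * (\<bar>?T$1\<bar> + L ?T)" by (rule infnorm_le_first)
  also have "\<dots> \<le> k^3 * (10 * (k^6 * ?p) + 10 * (k^6 * ?q))"
    using T1 T2 pq by (intro mult_left_mono) auto
  also have "\<dots> = 10 * k^9 * (?p + ?q)"
    by (simp add: algebra_simps eval_nat_numeral)
  finally show ?thesis .
qed

text \<open>If \<open>a\<close> is orthogonal to \<open>v\<close>, then \<open>a \<bullet> x\<close> only sees the component of \<open>x\<close> off the direction of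
\<open>v\<close>, that is, the cross product of \<open>x\<close> and \<open>v\<close>.\<close>

lemma plane_bound:
  assumes "a \<bullet> v = 0"
  shows "\<bar>v$1\<bar> * \<bar>a \<bullet> x\<bar> \<le> 2 * k * infnorm a * (infnorm x * L v + infnorm v * L x) * k"
proof -
  note c = component_le_infnorm_cart
  have "v$1 * (a \<bullet> x) = v$1 * (a \<bullet> x) - x$1 * (a \<bullet> v)" by (simp add: assms)
  also have "\<dots> = a$3 * (cross3 x v)$2 + a$2 * - (cross3 x v)$3"
    by (simp add: cross3_def inner_vec_def sum_3 algebra_simps)
  finally have e: "v$1 * (a \<bullet> x) = a$3 * (cross3 x v)$2 + a$2 * - (cross3 x v)$3" .
  have "\<bar>(cross3 x v)$i\<bar> \<le> k\<^sup>2 * (infnorm x * L v + infnorm v * L x)" for i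
    using c[of "cross3 x v" i] cross3_bound[of x v] by linarith
  then have "\<bar>a$j * (cross3 x v)$i\<bar> \<le> infnorm a * (k\<^sup>2 * (infnorm x * L v + infnorm v * L x))" for i j
    by (intro abs_mult_le c)
  from abs_add_le[OF this[of 3 2] this[of 2 3, THEN abs_minor_minus]]
  have "\<bar>v$1 * (a \<bullet> x)\<bar> \<le> 2 * (infnorm a * (k\<^sup>2 * (infnorm x * L v + infnorm v * L x)))"
    unfolding e by simp
  then show ?thesis by (simp add: abs_mult algebra_simps power2_eq_square)
qed

lemma plane_bound_Xi:
  assumes "a \<bullet> v = 0"
  shows "\<bar>v$1\<bar> * \<bar>a \<bullet> Xi_point \<xi>\<bar> \<le> 2 * infnorm a * L v"
proof -
  note c = component_le_infnorm_cart
  have "v$1 * (a \<bullet> Xi_point \<xi>) = v$1 * (a \<bullet> Xi_point \<xi>) - a \<bullet> v" by (simp add: assms)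
  also have "\<dots> = a$2 * (cross3 v (Xi_point \<xi>))$3 + a$3 * - (cross3 v (Xi_point \<xi>))$2"
    by (simp add: cross3_def Xi_point_def inner_vec_def sum_3 algebra_simps)
  finally have e: "v$1 * (a \<bullet> Xi_point \<xi>) = a$2 * (cross3 v (Xi_point \<xi>))$3 + a$3 * - (cross3 v (Xi_point \<xi>))$2" .
  have "\<bar>a$j * (cross3 v (Xi_point \<xi>))$i\<bar> \<le> infnorm a * L v" for i j
    unfolding err_def by (intro abs_mult_le c)
  from abs_add_le[OF this[of 2 3] this[of 3 2, THEN abs_minor_minus]]
  have "\<bar>v$1 * (a \<bullet> Xi_point \<xi>)\<bar> \<le> 2 * (infnorm a * L v)"
    unfolding e by simp
  then show ?thesis by (simp add: abs_mult algebra_simps)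
qed

end

section \<open>Logarithmic form of the estimates\<close>

text \<open>The condition states that \<open>1\<close>, \<open>\<xi>\<close>, \<open>\<xi>\<^sup>2\<close> are linearly independent over the rationals.\<close>

locale independent_point = point_bounds +
  assumes indep: "a \<in> int_points \<Longrightarrow> a \<bullet> Xi_point \<xi> \<noteq> 0"
begin

definition h :: "real ^ 3 \<Rightarrow> real" where "h x = ln (infnorm x)"
definition l :: "real ^ 3 \<Rightarrow> real" where "l x = ln (L x)"

text \<open>A single logarithmic constant that dominates the constants of all the estimates.\<close>

definition c :: real where "c = ln (1000 * k ^ 10)"

lemma inner_Xi: "a \<bullet> Xi_point \<xi> = a$1 + a$2 * \<xi> + a$3 * \<xi>\<^sup>2"
  by (simp add: inner_vec_def sum_3 Xi_point_def)

lemma err_pos: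
  assumes "x \<in> int_points" shows "0 < L x"
proof (rule ccontr)
  assume "\<not> 0 < L x"
  then have "L x = 0" using err_nonneg[of x] by simp
  then have U: "U1 x = 0" "U2 x = 0" using U1_le[of x] U2_le[of x] by auto
  show False
  proof (cases "x$1 = 0 \<and> x$2 = 0")
    case True
    then have "x = 0" using U by (simp add: vec_eq_iff forall_3)
    then show False using assms by (simp add: int_points_def)
  next
    case False
    let ?a = "vector [x$2, - x$1, 0] :: real ^ 3"
    have "?a \<in> int_points"
      using False assms by (auto simp: int_points_def forall_3 vec_eq_iff)
    moreover have "?a \<bullet> Xi_point \<xi> = 0" using U by (simp add: inner_Xi)
    ultimately show False using indep by blast
  qed
qed

lemma infnorm_pos: "x \<in> int_points \<Longrightarrow> 0 < infnorm x"
  using infnorm_int_points_ge_1[of x] by linarith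

lemma exp_h: "x \<in> int_points \<Longrightarrow> exp (h x) = infnorm x"
  and exp_l: "x \<in> int_points \<Longrightarrow> exp (l x) = L x"
  by (simp_all add: h_def l_def infnorm_pos err_pos)

lemma h_nonneg: "x \<in> int_points \<Longrightarrow> 0 \<le> h x"
  using infnorm_int_points_ge_1[of x] by (simp add: h_def)

lemma k_power_le: "i \<le> 10 \<Longrightarrow> k ^ i \<le> k ^ 10"
  by (intro power_increasing k_ge_1)

lemma exp_c: "exp c = 1000 * k ^ 10"
  using k_ge_1 by (simp add: c_def)

lemma c_pos: "0 < c"
proof -
  have "1 \<le> k ^ 10" by (rule one_le_power[OF k_ge_1])
  then have "1 < 1000 * k ^ 10" by simp
  then show ?thesis unfolding c_def by (rule ln_gt_zero)
qed

lemma exp_sum_le_max: "exp p + exp q \<le> 2 * exp (max p q)" for p q :: real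
  using add_mono[of "exp p" "exp (max p q)" "exp q" "exp (max p q)"] by simp

lemma ln_le_c_max:
  assumes "0 < A" "A \<le> b * k ^ i * (exp p + exp q)" "0 \<le> b" "b \<le> 500" "i \<le> 10"
  shows "ln A \<le> c + max p q"
proof -
  have "A \<le> b * k ^ i * (2 * exp (max p q))"
    using assms(2,3) by (rule_tac order_trans[OF assms(2)]) (intro mult_left_mono exp_sum_le_max, simp)
  also have "\<dots> = (2 * b * k ^ i) * exp (max p q)" by simp
  also have "\<dots> \<le> (1000 * k ^ 10) * exp (max p q)"
    using assms(3-5) k_power_le[of i] by (intro mult_right_mono mult_mono) auto
  also have "\<dots> = exp (c + max p q)" by (simp add: exp_add exp_c)
  finally show ?thesis
    using assms(1) by (metis exp_gt_zero ln_exp ln_le_cancel_iff)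
qed

lemma qdet_log:
  assumes "x \<in> int_points" "qdet x \<noteq> 0" shows "0 \<le> c + h x + l x"
proof -
  have "1 \<le> \<bar>qdet x\<bar>" using assms by (intro Ints_nonzero_abs_ge1 qdet_Ints)
  also have "\<dots> \<le> 2 * k ^ 1 * (exp (h x + l x) + exp (h x + l x))"
    using qdet_bound[of x] k_nonneg by (simp add: exp_add exp_h exp_l assms infnorm_pos err_pos)
  finally have "ln 1 \<le> c + max (h x + l x) (h x + l x)"
    by (intro ln_le_c_max[where b = 2 and i = 1]) auto
  then show ?thesis by simp
qed

lemma sandwich_log:
  assumes "x \<in> int_points" "y \<in> int_points" "z \<in> int_points" "sandwich x y z \<in> int_points"
    and "det3 x y z = 0"
  shows "h (sandwich x y z) \<le> c + max (h y + l x + l z) (h x + h z + l y)"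
    and "l (sandwich x y z) \<le> c + l z + max (h y + l x) (h x + l y)"
proof -
  have "infnorm (sandwich x y z) \<le> 10 * k^9 * (exp (h y + l x + l z) + exp (h x + h z + l y))"
    using infnorm_sandwich[OF assms(5)] by (simp add: exp_add exp_h exp_l assms)
  then show "h (sandwich x y z) \<le> c + max (h y + l x + l z) (h x + h z + l y)"
    unfolding h_def[of "sandwich x y z"]
    by (rule ln_le_c_max[rotated]) (use assms infnorm_pos in auto)
  have "L (sandwich x y z) \<le> 2 * k^4 * (exp (l z + (h y + l x)) + exp (l z + (h x + l y)))"
    using err_sandwich[OF assms(5)] by (simp add: exp_add exp_h exp_l assms distrib_left)
  then have "l (sandwich x y z) \<le> c + max (l z + (h y + l x)) (l z + (h x + l y))"
    unfolding l_def[of "sandwich x y z"]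
    by (rule ln_le_c_max[rotated]) (use assms err_pos in auto)
  then show "l (sandwich x y z) \<le> c + l z + max (h y + l x) (h x + l y)"
    by (simp add: max_add_distrib_right add.assoc)
qed

lemma det3_eq_0:
  assumes "x \<in> int_points" "y \<in> int_points" "z \<in> int_points"
    and "c + h x + l y + l z < 0" "c + h y + l x + l z < 0" "c + h z + l x + l y < 0"
  shows "det3 x y z = 0"
proof (rule ccontr)
  assume "det3 x y z \<noteq> 0"
  let ?m = "max (h x + l y + l z) (max (h y + l x + l z) (h z + l x + l y))"
  have "1 \<le> \<bar>det3 x y z\<bar>" using assms \<open>det3 x y z \<noteq> 0\<close> by (intro Ints_nonzero_abs_ge1 det3_Ints)
  also have "\<dots> \<le> 2 * k^2 * (exp (h x + l y + l z) + exp (h y + l x + l z) + exp (h z + l x + l y))"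
    using det3_bound[of x y z] by (simp add: exp_add exp_h exp_l assms)
  also have "\<dots> \<le> 2 * k^2 * (exp ?m + exp ?m + exp ?m)"
    by (intro mult_left_mono add_mono) auto
  also have "\<dots> = 3 * k^2 * (exp ?m + exp ?m)" by simp
  finally have "ln 1 \<le> c + max ?m ?m"
    by (intro ln_le_c_max[where i = 2 and b = 3]) auto
  then show False using assms by auto
qed

lemma cross3_log:
  assumes "x \<in> int_points" "y \<in> int_points" "cross3 x y \<noteq> 0"
  shows "h (cross3 x y) \<le> c + max (h x + l y) (h y + l x)"
  unfolding h_def[of "cross3 x y"]
proof (rule ln_le_c_max)
  show "infnorm (cross3 x y) \<le> 1 * k^2 * (exp (h x + l y) + exp (h y + l x))"
    using cross3_bound[of x y] by (simp add: exp_add exp_h exp_l assms)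
  show "0 < infnorm (cross3 x y)" using assms(3) by (simp add: infnorm_pos_lt)
qed auto

text \<open>Unless \<open>x\<close> is badly off the direction of \<open>\<Xi>\<close>, its first coordinate has the order of its norm.\<close>

lemma first_coordinate:
  assumes "v \<in> int_points" "l v \<le> h v - c"
  shows "infnorm v \<le> 2 * k^3 * \<bar>v$1\<bar>"
proof -
  have "L v \<le> exp (h v - c)" using assms by (simp add: exp_l[symmetric])
  then have "L v * exp c \<le> infnorm v"
    by (simp add: exp_diff exp_h assms field_simps)
  moreover have "L v * (2 * k^3) \<le> L v * exp c"
  proof (intro mult_left_mono err_nonneg)
    have "0 \<le> k ^ 10" by (intro zero_le_power k_nonneg)
    then show "2 * k^3 \<le> exp c" using k_power_le[of 3] unfolding exp_c by linarith
  qed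
  ultimately have "2 * (k^3 * L v) \<le> infnorm v" by (simp add: mult_ac)
  then show ?thesis using infnorm_le_first[of v] by (simp add: distrib_left)
qed

text \<open>An integer vector orthogonal to \<open>v\<close> but not to \<open>x\<close> cannot be too small, because \<open>\<bar>a \<bullet> x\<bar> \<ge> 1\<close>.\<close>

lemma plane_log:
  assumes "a \<in> int_points" "v \<in> int_points" "x \<in> int_points"
    and "l v \<le> h v - c" "a \<bullet> v = 0" "a \<bullet> x \<noteq> 0"
  shows "0 \<le> c + h a + max (h x + l v - h v) (l x)"
proof -
  have "a \<bullet> x \<in> \<int>" using assms by (auto simp: inner_vec_def sum_3 int_points_def)
  then have "1 \<le> \<bar>a \<bullet> x\<bar>" using assms by (intro Ints_nonzero_abs_ge1)
  have "infnorm v * \<bar>a \<bullet> x\<bar> \<le> 2 * k^3 * (\<bar>v$1\<bar> * \<bar>a \<bullet> x\<bar>)"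
    using mult_right_mono[OF first_coordinate[OF assms(2,4)], of "\<bar>a \<bullet> x\<bar>"] by (simp add: mult_ac)
  also have "\<dots> \<le> 2 * k^3 * (2 * k * infnorm a * (infnorm x * L v + infnorm v * L x) * k)"
    by (intro mult_left_mono plane_bound assms) auto
  also have "\<dots> = infnorm v * (4 * k^5 * (infnorm a * (infnorm x * L v / infnorm v) + infnorm a * L x))"
    using infnorm_pos[OF assms(2)] by (simp add: field_simps eval_nat_numeral)
  finally have "\<bar>a \<bullet> x\<bar> \<le> 4 * k^5 * (infnorm a * (infnorm x * L v / infnorm v) + infnorm a * L x)"
    using infnorm_pos[OF assms(2)] by simp
  then have "1 \<le> 4 * k^5 * (exp (h a + (h x + l v - h v)) + exp (h a + l x))"
    using \<open>1 \<le> \<bar>a \<bullet> x\<bar>\<close> by (simp add: exp_add exp_diff exp_h exp_l assms)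
  then have "ln 1 \<le> c + max (h a + (h x + l v - h v)) (h a + l x)"
    by (rule ln_le_c_max[rotated]) auto
  then show ?thesis by (simp add: max_add_distrib_right add.assoc)
qed

lemma plane_log_Xi:
  assumes "a \<in> int_points" "v \<in> int_points" "l v \<le> h v - c" "a \<bullet> v = 0"
  shows "ln \<bar>a \<bullet> Xi_point \<xi>\<bar> \<le> c + h a + l v - h v"
proof -
  have "infnorm v * \<bar>a \<bullet> Xi_point \<xi>\<bar> \<le> 2 * k^3 * (\<bar>v$1\<bar> * \<bar>a \<bullet> Xi_point \<xi>\<bar>)"
    using mult_right_mono[OF first_coordinate[OF assms(2,3)], of "\<bar>a \<bullet> Xi_point \<xi>\<bar>"] by (simp add: mult_ac)
  also have "\<dots> \<le> 2 * k^3 * (2 * infnorm a * L v)"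
    by (intro mult_left_mono plane_bound_Xi assms) auto
  finally have "\<bar>a \<bullet> Xi_point \<xi>\<bar> \<le> 2 * k^3 * (infnorm a * L v / infnorm v + infnorm a * L v / infnorm v)"
    using infnorm_pos[OF assms(2)] by (simp add: field_simps)
  then have "\<bar>a \<bullet> Xi_point \<xi>\<bar> \<le> 2 * k^3 * (exp (h a + l v - h v) + exp (h a + l v - h v))"
    by (simp add: exp_add exp_diff exp_h exp_l assms)
  then have "ln \<bar>a \<bullet> Xi_point \<xi>\<bar> \<le> c + max (h a + l v - h v) (h a + l v - h v)"
    by (rule ln_le_c_max[rotated]) (use indep assms in auto)
  then show ?thesis by simp
qed

end

section \<open>Nonzero determinants\<close>

text \<open>Here \<open>\<nu>\<close> is a uniform exponent above \<open>1 / sqrt 3\<close> that is realised by good points of every level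
\<open>e\<close>. The upper bound \<open>58/100\<close> costs nothing, as \<open>\<nu>\<close> may be decreased, and keeps \<open>1 / \<nu>\<close> near \<open>sqrt 3\<close>.\<close>

locale dense_good_points = independent_point +
  fixes \<nu> :: real
  assumes nu_pos: "0 < \<nu>" and nu_gt: "1 < 3 * \<nu>\<^sup>2" and nu_lt: "\<nu> < 58/100"
    and good_points: "0 < e \<Longrightarrow> \<forall>\<^sub>F t in at_top. \<exists>x \<in> int_points.
      h x \<le> t \<and> l x \<le> - \<nu> * t \<and> l x \<le> - (1 - e) * h x"
begin

lemma inv_nu_lt: "1 / \<nu> < 17321/10000"
proof -
  have "(10000/17321)\<^sup>2 < (1/3 :: real)" by (simp add: power_divide)
  then have "(10000/17321)\<^sup>2 < \<nu>\<^sup>2" using nu_gt by linarith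
  then have "10000/17321 < \<nu>" using nu_pos by (rule power2_less_imp_less[OF _ less_imp_le])
  then show ?thesis using nu_pos by (simp add: field_simps)
qed

lemma rational_gap:
  fixes B :: int
  shows "\<exists>\<delta>>0. \<forall>(a :: int) (b :: int). b \<noteq> 0 \<longrightarrow> \<bar>b\<bar> \<le> B \<longrightarrow> \<delta> \<le> \<bar>a - \<xi> * b\<bar>"
proof -
  let ?S = "{b. b \<noteq> 0 \<and> \<bar>b\<bar> \<le> B}"
  let ?f = "\<lambda>b. \<bar>\<xi> * of_int b - of_int (round (\<xi> * of_int b))\<bar>"
  have "?S \<subseteq> {-B..B}" by auto
  then have fin: "finite ?S" by (rule finite_subset) simp
  have pos: "0 < ?f b" if "b \<noteq> 0" for b
  proof -
    let ?a = "vector [of_int (round (\<xi> * of_int b)), - of_int b, 0] :: real ^ 3"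
    have "?a \<in> int_points" using that by (auto simp: int_points_def forall_3 vec_eq_iff)
    then have "?a \<bullet> Xi_point \<xi> \<noteq> 0" by (rule indep)
    then show ?thesis by (simp add: inner_Xi mult.commute)
  qed
  define d where "d = Min (insert 1 (?f ` ?S))"
  have "0 < d" unfolding d_def using fin pos by (subst Min_gr_iff) auto
  moreover have "d \<le> \<bar>a - \<xi> * b\<bar>" if "b \<noteq> 0" "\<bar>b\<bar> \<le> B" for a b :: int
  proof -
    have "d \<le> ?f b" unfolding d_def using fin that by (intro Min_le) auto
    also have "\<dots> \<le> \<bar>\<xi> * b - a\<bar>" by (rule round_diff_minimal)
    finally show ?thesis by (simp add: abs_minus_commute)
  qed
  ultimately show ?thesis by (intro exI[of _ d] conjI allI impI)
qed

text \<open>If the determinant of \<open>x\<close> vanishes, then \<open>x\<close> is a multiple of \<open>(b\<^sup>2, a b, a\<^sup>2)\<close> with \<open>a / b\<close> very close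
to \<open>\<xi>\<close>. The uniform exponent provides a point \<open>y\<close> of size about \<open>\<bar>b\<bar> powr (1 / \<nu>)\<close>, which is less
than \<open>b\<^sup>2\<close>. The integers \<open>a y\<^sub>1 - b y\<^sub>2\<close> and \<open>a y\<^sub>2 - b y\<^sub>3\<close> are smaller than \<open>1\<close>, hence zero, so \<open>b\<^sup>2\<close>
divides \<open>y\<^sub>1\<close>, a contradiction. The threshold \<open>M\<close> makes \<open>\<bar>b\<bar>\<close> large enough for this.\<close>

lemma qdet_nonzero: "\<exists>M. \<forall>x \<in> int_points. l x \<le> - M \<longrightarrow> l x \<le> - h x / 2 \<longrightarrow> qdet x \<noteq> 0"
proof -
  obtain t0 where t0: "\<And>t. t0 \<le> t \<Longrightarrow> \<exists>y \<in> int_points. h y \<le> t \<and> l y \<le> - \<nu> * t"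
    using good_points[of 1] unfolding eventually_at_top_linorder by fastforce
  define B where "B = max (11 * c) (\<nu> * t0)"
  obtain \<delta> where \<delta>: "\<delta> > 0"
    "\<And>(a :: int) (b :: int). b \<noteq> 0 \<Longrightarrow> \<bar>b\<bar> \<le> \<lceil>exp B\<rceil> \<Longrightarrow> \<delta> \<le> \<bar>a - \<xi> * b\<bar>"
    using rational_gap[of "\<lceil>exp B\<rceil>"] by auto
  define M where "M = max c (ln (2 * k) - ln \<delta>)"
  have k_pos: "0 < k" using k_ge_1 by simp
  have kc: "k * exp (- c) \<le> 1/4"
  proof -
    have "k ^ 1 \<le> k ^ 10" "0 \<le> k ^ 10" using k_nonneg by (intro k_power_le zero_le_power; simp)+
    then have "k * 4 \<le> 1000 * k ^ 10" unfolding power_one_right by linarith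
    then show ?thesis by (simp add: exp_minus exp_c divide_simps)
  qed
  have False if x: "x \<in> int_points" "l x \<le> - M" "l x \<le> - h x / 2" and q0: "qdet x = 0" for x
  proof -
    obtain p q r :: int where pqr: "x$1 = p" "x$2 = q" "x$3 = r"
      using int_points_D[OF x(1)] by (metis Ints_cases)
    have "infnorm x \<le> 2 * k^3 * \<bar>x$1\<bar>"
      using x h_nonneg[OF x(1)] by (intro first_coordinate) (auto simp: M_def)
    then have p0: "p \<noteq> 0" using infnorm_pos[OF x(1)] pqr by auto
    have "real_of_int (p * r) = of_int (q\<^sup>2)"
      using q0 pqr by (simp add: qdet_def)
    then have prq: "p * r = q\<^sup>2" by (simp only: of_int_eq_iff)
    obtain b a d where bad: "p = b * d" "q = a * d" "coprime b a" "d \<noteq> 0"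
      using gcd_coprime_exists[of p q] p0 by auto
    have b0: "b \<noteq> 0" using bad p0 by auto
    have "d * (b * r) = d * (d * a\<^sup>2)" using prq bad by (simp add: power2_eq_square mult_ac)
    then have "b * r = d * a\<^sup>2" using bad(4) by simp
    then have "b dvd d * a\<^sup>2" by (metis dvd_triv_left)
    moreover have "coprime b (a\<^sup>2)" using bad(3) by simp
    ultimately have "b dvd d" by (simp add: coprime_dvd_mult_left_iff)
    then obtain m where m: "d = b * m" by auto
    have m0: "m \<noteq> 0" using m bad(4) by auto
    define \<beta> where "\<beta> = ln \<bar>real_of_int b\<bar>"
    have eb: "exp \<beta> = \<bar>real_of_int b\<bar>" using b0 by (simp add: \<beta>_def)
    have b1: "1 \<le> \<bar>real_of_int b\<bar>" using b0 by linarith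
    have m1: "1 \<le> \<bar>real_of_int m\<bar>" using m0 by linarith
    have e2b: "exp (2 * \<beta>) = \<bar>real_of_int b\<bar> * \<bar>real_of_int b\<bar>"
      by (metis eb exp_add mult_2)
    have "exp (2 * \<beta>) * 1 \<le> exp (2 * \<beta>) * \<bar>real_of_int m\<bar>"
      using m1 by (intro mult_left_mono) auto
    also have "\<dots> = \<bar>x$1\<bar>" using pqr bad m by (simp add: e2b abs_mult)
    also have "\<dots> \<le> infnorm x" by (rule component_le_infnorm_cart)
    finally have "2 * \<beta> \<le> h x" using infnorm_pos[OF x(1)] by (simp add: h_def ln_ge_iff)
    then have lb: "l x \<le> - \<beta>" using x(3) by simp
    have Ux: "\<bar>a - \<xi> * b\<bar> \<le> k * exp (l x - \<beta>)"
    proof -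
      have "exp \<beta> * \<bar>a - \<xi> * b\<bar> * 1 \<le> exp \<beta> * \<bar>a - \<xi> * b\<bar> * \<bar>real_of_int m\<bar>"
        using m1 by (intro mult_left_mono) auto
      also have "\<dots> = \<bar>real_of_int b * (a - \<xi> * b) * m\<bar>" by (simp add: eb abs_mult)
      also have "real_of_int b * (a - \<xi> * b) * m = U1 x"
        using pqr bad m by (simp add: algebra_simps)
      also have "\<bar>U1 x\<bar> \<le> k * exp (l x)" using U1_le[of x] by (simp add: exp_l x)
      finally show ?thesis by (simp add: exp_diff field_simps)
    qed
    have \<beta>0: "0 \<le> \<beta>" using b1 by (simp add: \<beta>_def)
    show False
    proof (cases "\<beta> \<le> B")
      case True
      then have "\<bar>real_of_int b\<bar> \<le> exp B" using eb by (metis exp_le_cancel_iff)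
      then have "\<bar>b\<bar> \<le> \<lceil>exp B\<rceil>" by linarith
      then have "\<delta> \<le> \<bar>a - \<xi> * b\<bar>" using b0 \<delta>(2) by blast
      also have "\<dots> \<le> k * exp (- M)"
        using Ux x(2,3) \<beta>0 k_pos by (elim order_trans, intro mult_left_mono) auto
      also have "\<dots> \<le> k * exp (- (ln (2 * k) - ln \<delta>))"
        using k_pos by (intro mult_left_mono) (auto simp: M_def)
      also have "\<dots> = \<delta> / 2" using k_pos \<delta>(1) by (simp add: exp_diff exp_minus)
      finally show False using \<delta>(1) by simp
    next
      case False
      \<comment> \<open>With this size of \<open>y\<close>, the bound \<open>L y \<le> exp (- \<nu> t)\<close> beats \<open>\<bar>b\<bar>\<close> by the constant \<open>exp c\<close>.\<close>
      define t where "t = (\<beta> + c) / \<nu>"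
      have lt: "\<nu> * t = \<beta> + c" using nu_pos by (simp add: t_def)
      have "\<nu> * t0 \<le> \<nu> * t" using False c_pos unfolding lt B_def by simp
      then have "t0 \<le> t" using nu_pos by simp
      then obtain y where y: "y \<in> int_points" "h y \<le> t" "l y \<le> - (\<beta> + c)"
        using t0 lt by force
      have "t = (\<beta> + c) * (1 / \<nu>)" by (simp add: t_def)
      also have "\<dots> \<le> (\<beta> + c) * (17321/10000)"
        using inv_nu_lt \<beta>0 c_pos by (intro mult_left_mono) auto
      finally have t_le: "t \<le> 2 * \<beta> - c"
        using False c_pos by (simp add: B_def)
      have small: "\<bar>y$i * (a - \<xi> * b) - b * u\<bar> < 1" if "\<bar>u\<bar> \<le> k * L y" for u :: real and i
      proof -
        have "\<bar>y$i * (a - \<xi> * b) - b * u\<bar> \<le> infnorm y * (k * exp (l x - \<beta>)) + exp \<beta> * (k * L y)"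
          using that by (intro abs_minor_le component_le_infnorm_cart Ux) (simp_all add: eb)
        also have "\<dots> = k * exp (h y + l x - \<beta>) + k * exp (\<beta> + l y)"
          using y(1) by (simp add: exp_add exp_diff exp_h exp_l)
        also have "\<dots> \<le> k * exp (- c) + k * exp (- c)"
          using y lb t_le k_pos by (intro add_mono mult_left_mono) auto
        finally show ?thesis using kc by simp
      qed
      obtain y1 y2 y3 :: int where yy: "y$1 = y1" "y$2 = y2" "y$3 = y3"
        using int_points_D[OF y(1)] by (metis Ints_cases)
      have "\<bar>real_of_int (a * y1 - b * y2)\<bar> < 1"
        using small[OF U1_le[of y], of 1] yy by (simp add: algebra_simps)
      then have e1: "a * y1 = b * y2" by linarith
      have "\<bar>real_of_int (a * y2 - b * y3)\<bar> < 1"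
        using small[OF U2_le[of y], of 2] yy by (simp add: algebra_simps)
      then have e2: "a * y2 = b * y3" by linarith
      have "b dvd y1" using e1 bad(3) by (metis coprime_dvd_mult_right_iff dvd_triv_left)
      then obtain s where s: "y1 = b * s" by auto
      then have s2: "y2 = a * s" using e1 b0 by simp
      then have "b dvd s" using e2 bad(3)
        by (metis coprime_dvd_mult_right_iff dvd_triv_left)
      then obtain u where u: "s = b * u" by auto
      have "u \<noteq> 0"
      proof
        assume "u = 0"
        then have "y1 = 0" "y2 = 0" "y3 = 0" using s s2 u e2 b0 by auto
        then have "y = 0" using yy by (simp add: vec_eq_iff forall_3)
        then show False using y(1) by (simp add: int_points_def)
      qed
      then have u1: "1 \<le> \<bar>real_of_int u\<bar>" by linarith
      have "exp (2 * \<beta>) * 1 \<le> exp (2 * \<beta>) * \<bar>real_of_int u\<bar>"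
        using u1 by (intro mult_left_mono) auto
      also have "\<dots> = \<bar>y$1\<bar>" using yy s u by (simp add: e2b abs_mult)
      also have "\<dots> \<le> infnorm y" by (rule component_le_infnorm_cart)
      finally have "2 * \<beta> \<le> h y" using infnorm_pos[OF y(1)] by (simp add: h_def ln_ge_iff)
      then show False using y(2) t_le c_pos by simp
    qed
  qed
  then show ?thesis by blast
qed

end

section \<open>Spacing of good points\<close>

text \<open>The parameters: consecutive good points can be found within a factor \<open>\<sigma>\<close> of logarithmic size, and
\<open>s\<close> is slightly larger than \<open>\<sigma>\<close> so as to absorb errors; both lie between \<open>1 / \<nu>\<close> and \<open>sqrt 3\<close>. The level
\<open>e\<close> is tiny compared with all the gaps between these numbers, and \<open>M\<close> is a size beyond which
constants are negligible, \<open>c \<le> e M\<close>.\<close>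

locale scale = dense_good_points +
  fixes s \<sigma> e M :: real
  assumes e_pos: "0 < e" and e_le: "e \<le> 1/1000000"
    and s_sq: "s\<^sup>2 \<le> 3 - 1000000 * e"
    and sigma: "1 + 1000 * e \<le> \<nu> * \<sigma>" "\<sigma> + 1000 * e \<le> s"
    and M_pos: "0 < M" and c_le: "c \<le> e * M"
    and nonzero: "x \<in> int_points \<Longrightarrow> l x \<le> - M / 2 \<Longrightarrow> l x \<le> - h x / 2 \<Longrightarrow> qdet x \<noteq> 0"
    and next_point: "M \<le> t \<Longrightarrow> \<exists>x \<in> int_points.
      h x \<le> t \<and> l x \<le> - \<nu> * t \<and> l x \<le> - (1 - e) * h x"
begin

text \<open>Two levels occur: \<open>e\<close> for the members of the chain, and \<open>100 * e\<close> for the points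
derived from them.\<close>

definition good :: "real \<Rightarrow> real ^ 3 \<Rightarrow> bool" where
  "good f x \<longleftrightarrow> x \<in> int_points \<and> M \<le> h x \<and> l x \<le> - (1 - f) * h x"

lemma good_int: "good f x \<Longrightarrow> x \<in> int_points"
  and good_M: "good f x \<Longrightarrow> M \<le> h x"
  and good_pos: "good f x \<Longrightarrow> 0 < h x"
  and good_l: "good f x \<Longrightarrow> l x \<le> - h x + f * h x"
  using M_pos by (auto simp: good_def algebra_simps)

lemma good_mono: "good f x \<Longrightarrow> f \<le> g \<Longrightarrow> good g x"
  using M_pos by (auto simp: good_def algebra_simps intro: order_trans mult_right_mono)

lemma good_100: "good e x \<Longrightarrow> good (100 * e) x"
  using good_mono e_pos by simp

lemma c_le_eh: "M \<le> H \<Longrightarrow> c \<le> e * H"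
  using c_le mult_left_mono[of M H e] e_pos by linarith

lemma eh_small: "0 \<le> H \<Longrightarrow> e * H \<le> H / 1000000"
  using mult_right_mono[OF e_le, of H] by simp

lemma sigma_gt: "172/100 < \<sigma>"
proof (rule ccontr)
  assume "\<not> 172/100 < \<sigma>"
  then have "\<nu> * \<sigma> \<le> \<nu> * (172/100)" using nu_pos by (intro mult_left_mono) auto
  then show False using sigma(1) nu_lt e_pos by simp
qed

lemma s_gt: "172/100 < s"
  using sigma sigma_gt e_pos by linarith

lemma s_lt: "s + 1000 * e < 17321/10000"
proof (rule ccontr)
  assume "\<not> s + 1000 * e < 17321/10000"
  then have "(17321/10000 - 1000 * e)\<^sup>2 \<le> s\<^sup>2"
    using e_le by (intro power_mono) auto
  moreover have "(17321/10000 - 1000 * e)\<^sup>2 = (17321/10000)\<^sup>2 - 34642/10 * e + 1000000 * e\<^sup>2"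
    by (simp add: power2_eq_square algebra_simps)
  moreover have "(17321/10000)\<^sup>2 > (3 :: real)" by (simp add: power_divide)
  moreover have "0 \<le> e\<^sup>2" by simp
  ultimately show False using s_sq e_pos by linarith
qed

lemma good_qdet: assumes "good (100 * e) x" shows "qdet x \<noteq> 0"
proof (rule nonzero)
  have "l x \<le> - h x / 2"
    using good_l[OF assms] good_pos[OF assms] eh_small[of "h x"] unfolding mult.assoc by linarith
  then show "l x \<le> - h x / 2" "l x \<le> - M / 2" using good_M[OF assms] by linarith+
qed (use assms in \<open>auto simp: good_def\<close>)

lemma good_lower: assumes "good (100 * e) x" shows "- h x - e * h x \<le> l x"
  using qdet_log[OF good_int[OF assms] good_qdet[OF assms]] c_le_eh[OF good_M[OF assms]] by linarith

lemma next_good: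
  assumes "M \<le> H"
  shows "\<exists>x. good e x \<and> h x \<le> \<sigma> * H \<and> (1 + 900 * e) * H \<le> h x"
proof -
  have H: "0 < H" using assms M_pos by linarith
  have "1 * H \<le> \<sigma> * H" using sigma_gt H by (intro mult_right_mono) auto
  then have "M \<le> \<sigma> * H" using assms by linarith
  then obtain x where x: "x \<in> int_points" "h x \<le> \<sigma> * H" "l x \<le> - \<nu> * (\<sigma> * H)"
    "l x \<le> - (1 - e) * h x" using next_point by blast
  have l1: "l x \<le> - H - 1000 * (e * H)"
    using x(3) mult_right_mono[OF sigma(1), of H] H by (simp add: algebra_simps)
  have "l x \<le> - h x + e * h x" using x(4) by (simp add: algebra_simps)
  then have l2: "l x \<le> - h x / 2" using eh_small[OF h_nonneg[OF x(1)]] h_nonneg[OF x(1)] by linarith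
  have eH: "0 \<le> e * H" using e_pos H by simp
  have "qdet x \<noteq> 0" using l1 l2 x(1) eH assms M_pos by (intro nonzero) auto
  then have "H + 1000 * (e * H) \<le> c + h x" using qdet_log[OF x(1)] l1 by linarith
  then have hx: "H + 900 * (e * H) \<le> h x" using c_le_eh[OF assms] eH by linarith
  then have "good e x" using x assms eH by (auto simp: good_def)
  then show ?thesis using x(2) hx by (auto simp: algebra_simps)
qed

text \<open>A plane of too small height through a good point \<open>v\<close> must contain the next good point as well, by
\<open>plane_log\<close>.\<close>

lemma next_good_in_plane:
  assumes v: "good (100 * e) v" and a: "a \<in> int_points" "a \<bullet> v = 0" "h a < (2 - s) * h v"
  shows "\<exists>x. good (100 * e) x \<and> a \<bullet> x = 0 \<and> h a < (2 - s) * h x \<and> h v + 900 * (e * M) \<le> h x"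
proof -
  obtain x where x: "good e x" "h x \<le> \<sigma> * h v" "(1 + 900 * e) * h v \<le> h x"
    using next_good[OF good_M[OF v]] by blast
  have H: "0 < h v" "M \<le> h v" using good_pos good_M v by auto
  have hx: "h v + 900 * (e * h v) \<le> h x" using x(3) by (simp add: algebra_simps)
  have eH: "0 \<le> e * h v" "e * M \<le> e * h v" using e_pos H by simp_all
  have c1: "c \<le> e * h v" using c_le_eh H by simp
  have lv: "l v \<le> - h v + 100 * (e * h v)" using good_l[OF v] by simp
  have sv: "\<sigma> * h v + 1000 * (e * h v) \<le> s * h v"
    using mult_right_mono[OF sigma(2), of "h v"] H by (simp add: algebra_simps)
  have s17: "172/100 * h v \<le> s * h v" using s_gt H by (intro mult_right_mono) auto
  have ha: "h a < 2 * h v - s * h v" using a(3) by (simp add: algebra_simps)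
  have "a \<bullet> x = 0"
  proof (rule ccontr)
    assume "a \<bullet> x \<noteq> 0"
    moreover have "l v \<le> h v - c" using lv c1 eh_small[of "h v"] H by linarith
    ultimately have "0 \<le> c + h a + max (h x + l v - h v) (l x)"
      using a v x by (intro plane_log) (auto simp: good_def)
    moreover have "c + h a + (h x + l v - h v) < 0"
      using c1 ha x(2) lv sv eH by linarith
    moreover have "l x \<le> - h x / 2"
      using good_l[OF x(1)] eh_small[of "h x"] good_pos[OF x(1)] by linarith
    then have "c + h a + l x < 0"
      using c1 ha s17 hx H eh_small[of "h v"] eH by linarith
    ultimately show False by linarith
  qed
  moreover have "(2 - s) * h v \<le> (2 - s) * h x"
    using s_lt e_pos hx eH by (intro mult_left_mono) auto
  ultimately show ?thesis
    using good_100[OF x(1)] a(3) hx eH by (intro exI[of _ x]) auto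
qed

text \<open>Otherwise the plane contains good points of arbitrarily large size, whose directions
converge to \<open>\<Xi>\<close>; then \<open>\<Xi>\<close> would lie in a rational plane.\<close>

lemma plane_height:
  assumes v: "good (100 * e) v" and a: "a \<in> int_points" "a \<bullet> v = 0"
  shows "(2 - s) * h v \<le> h a"
proof (rule ccontr)
  assume neg: "\<not> (2 - s) * h v \<le> h a"
  have *: "\<exists>x. good (100 * e) x \<and> a \<bullet> x = 0 \<and> h a < (2 - s) * h x \<and> real n * (900 * (e * M)) \<le> h x" for n
  proof (induction n)
    case 0
    then show ?case using v a neg good_pos[OF v] by (intro exI[of _ v]) auto
  next
    case (Suc n)
    then obtain x where x: "good (100 * e) x" "a \<bullet> x = 0" "h a < (2 - s) * h x"
      "real n * (900 * (e * M)) \<le> h x" by blast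
    obtain y where y: "good (100 * e) y" "a \<bullet> y = 0" "h a < (2 - s) * h y"
      "h x + 900 * (e * M) \<le> h y" using next_good_in_plane[OF x(1) a(1) x(2,3)] by blast
    have "real (Suc n) * (900 * (e * M)) \<le> h y" using x(4) y(4) by (simp add: distrib_right)
    then show ?case using y by blast
  qed
  have pos: "0 < 900 * (e * M)" using e_pos M_pos by simp
  then obtain n :: nat where n: "- ln \<bar>a \<bullet> Xi_point \<xi>\<bar> < real n * (900 * (e * M))"
    using ex_less_of_nat_mult by blast
  obtain x where x: "good (100 * e) x" "a \<bullet> x = 0" "h a < (2 - s) * h x"
    "real n * (900 * (e * M)) \<le> h x" using *[of n] by blast
  have H: "0 < h x" "M \<le> h x" using good_pos good_M x by auto
  have lv: "l x \<le> - h x + 100 * (e * h x)" using good_l[OF x(1)] by simp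
  have c1: "c \<le> e * h x" using c_le_eh H by simp
  have ex: "e * h x \<le> h x / 1000000" using eh_small H by simp
  have s17: "172/100 * h x \<le> s * h x" using s_gt H by (intro mult_right_mono) auto
  have ha: "h a < 2 * h x - s * h x" using x(3) by (simp add: algebra_simps)
  have "l x \<le> h x - c" using lv c1 ex H by linarith
  then have "ln \<bar>a \<bullet> Xi_point \<xi>\<bar> \<le> c + h a + l x - h x"
    using good_int[OF x(1)] x(2) a(1) by (intro plane_log_Xi)
  then have "ln \<bar>a \<bullet> Xi_point \<xi>\<bar> \<le> - h x"
    using lv c1 ex H ha s17 by linarith
  then show False using n x(4) by linarith
qed

text \<open>The cross product of \<open>u\<close> and \<open>v\<close> has logarithmic size about \<open>h v - h u\<close>, and it is orthogonal to
\<open>v\<close>, so \<open>plane_height\<close> applies.\<close>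

lemma spacing:
  assumes u: "good (100 * e) u" and v: "good (100 * e) v" and "h u \<le> h v" "cross3 u v \<noteq> 0"
  shows "h u \<le> (s - 1 + 101 * e) * h v"
proof -
  let ?a = "cross3 u v"
  have a: "?a \<in> int_points" using assms good_int by (intro cross3_int_points) auto
  have "(2 - s) * h v \<le> h ?a" by (rule plane_height[OF v a]) (rule dot_cross_self)
  also have "\<dots> \<le> c + max (h u + l v) (h v + l u)"
    using assms good_int by (intro cross3_log) auto
  finally have *: "(2 - s) * h v \<le> c + max (h u + l v) (h v + l u)" .
  have "e * h u \<le> e * h v" using assms(3) e_pos by simp
  then have "max (h u + l v) (h v + l u) \<le> h v - h u + 100 * (e * h v)"
    using good_l[OF u] good_l[OF v] assms(3) by auto
  then have "(2 - s) * h v \<le> h v - h u + 101 * (e * h v)"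
    using * c_le_eh[OF good_M[OF v]] by linarith
  then show ?thesis by (simp add: algebra_simps)
qed

lemma spacing_numeric:
  assumes "good (100 * e) u" and "good (100 * e) v" and "h u \<le> h v" "cross3 u v \<noteq> 0"
  shows "h u \<le> 7321/10000 * h v"
proof -
  have "(s - 1 + 101 * e) * h v \<le> 7321/10000 * h v"
    using s_lt e_pos good_pos[OF assms(2)] by (intro mult_right_mono) auto
  then show ?thesis using spacing[OF assms] by linarith
qed

lemma proportional:
  assumes u: "u \<in> int_points" and v: "v \<in> int_points" and "cross3 u v = 0"
  obtains \<rho> where "u = \<rho> *\<^sub>R v" "ln \<bar>\<rho>\<bar> = h u - h v" "ln \<bar>\<rho>\<bar> = l u - l v" "\<rho> \<noteq> 0"
proof -
  have "v \<noteq> 0" "u \<noteq> 0" using u v by (auto simp: int_points_def)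
  have "collinear {0, v, u}" using assms(3) by (simp add: cross_eq_0 insert_commute)
  then obtain \<rho> where \<rho>: "u = \<rho> *\<^sub>R v" using \<open>v \<noteq> 0\<close> \<open>u \<noteq> 0\<close> by (auto simp: collinear_lemma)
  then have \<rho>0: "\<rho> \<noteq> 0" using \<open>u \<noteq> 0\<close> by auto
  have "infnorm u = \<bar>\<rho>\<bar> * infnorm v" by (simp add: \<rho> infnorm_mul)
  then have 1: "ln \<bar>\<rho>\<bar> = h u - h v"
    using \<rho>0 infnorm_pos[OF v] by (simp add: h_def ln_mult)
  have "L u = \<bar>\<rho>\<bar> * L v" by (simp add: \<rho> err_def cross_mult_left infnorm_mul)
  then have 2: "ln \<bar>\<rho>\<bar> = l u - l v"
    using \<rho>0 err_pos[OF v] by (simp add: l_def ln_mult)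
  show ?thesis using that \<rho> \<rho>0 1 2 by blast
qed

text \<open>Scaling a point multiplies \<open>N\<close> and \<open>L\<close> by the same factor, while both points have \<open>L\<close> close
to \<open>1 / N\<close>. So the factor is close to \<open>1\<close>.\<close>

lemma proportional_height:
  assumes u: "good (100 * e) u" and v: "good (100 * e) v" and "cross3 u v = 0"
  shows "h u \<le> h v + 60 * (e * h v)"
proof -
  have "h u - h v = l u - l v"
    using proportional[OF good_int[OF u] good_int[OF v] assms(3)] by metis
  then have *: "2 * h u - 100 * (e * h u) \<le> 2 * h v + e * h v"
    using good_l[OF u] good_lower[OF v] by simp
  have H: "0 < h u" "0 < h v" using good_pos u v by auto
  have "e * h u \<le> h u / 1000000" using eh_small H by simp
  moreover have "e * h v \<le> h v / 1000000" using eh_small H by simp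
  ultimately have "h u \<le> 101/100 * h v" using * H by linarith
  then have "e * h u \<le> e * (101/100 * h v)" using e_pos by (intro mult_left_mono) auto
  moreover have "0 \<le> e * h v" using e_pos H by simp
  ultimately show ?thesis using * by linarith
qed

text \<open>The determinant of the product is a nonzero integer, so the upper bounds for \<open>N\<close> and \<open>L\<close> are nearly
attained, and the product is a good point of the predicted size. The order \<open>h x \<le> h y\<close> decides which of the
two terms in \<open>sandwich_log\<close> dominates.\<close>

lemma sandwich_good:
  assumes x: "good e x" and y: "good e y" and z: "good e z" and det: "det3 x y z = 0"
    and B: "h x \<le> h y" "h y \<le> B" "h z \<le> B" "B \<le> 10 * h x + 10 * h z - 10 * h y" "100 * M \<le> B"
  shows "good (100 * e) (sandwich x y z)"
    and "\<bar>h (sandwich x y z) - (h x + h z - h y)\<bar> \<le> 4 * (e * B)"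
proof -
  let ?w = "sandwich x y z" and ?s = "h x + h z - h y"
  note xyz = x[THEN good_int] y[THEN good_int] z[THEN good_int]
  have q: "qdet x \<noteq> 0" "qdet y \<noteq> 0" "qdet z \<noteq> 0" using good_qdet good_100 x y z by auto
  have w: "?w \<in> int_points" using sandwich_int_points[OF xyz det q] .
  have qw: "qdet ?w \<noteq> 0" using q by (simp add: qdet_sandwich det)
  have le: "e * h x \<le> e * B" "e * h y \<le> e * B" "e * h z \<le> e * B"
    using B e_pos by (intro mult_left_mono; linarith)+
  have cB: "c \<le> e * B" using B M_pos by (intro c_le_eh) simp
  note l = good_l[OF x] good_l[OF y] good_l[OF z]
  have B0: "0 < B" using B M_pos by linarith
  then have "0 < ?s" using B(4) by linarith
  have eB: "e * B \<le> B / 1000000" "0 \<le> e * B" using eh_small B0 e_pos by simp_all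
  have "max (h y + l x + l z) (h x + h z + l y) \<le> ?s + 2 * (e * B)"
    using l le B \<open>0 < ?s\<close> eB by (intro max.boundedI) linarith+
  then have hw: "h ?w \<le> ?s + 3 * (e * B)"
    using sandwich_log(1)[OF xyz w det] cB by linarith
  have "max (h y + l x) (h x + l y) \<le> h y - h x + e * B"
    using l le B \<open>0 < ?s\<close> eB by (intro max.boundedI) linarith+
  then have lw: "l ?w \<le> - ?s + 3 * (e * B)"
    using sandwich_log(2)[OF xyz w det] cB l le by linarith
  have "0 \<le> c + h ?w + l ?w" by (rule qdet_log[OF w qw])
  then have hw2: "?s - 4 * (e * B) \<le> h ?w" using lw cB by linarith
  show "\<bar>h ?w - ?s\<bar> \<le> 4 * (e * B)" using hw hw2 eB by (simp add: abs_le_iff)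
  have "B \<le> 11 * h ?w" using B B0 hw2 eB by linarith
  then have "e * B \<le> e * (11 * h ?w)" using e_pos by (intro mult_left_mono) auto
  then have "e * B \<le> 11 * (e * h ?w)" by (simp add: algebra_simps)
  then have "6 * (e * B) \<le> 100 * (e * h ?w)" using eB by linarith
  then have "l ?w \<le> - h ?w + 100 * (e * h ?w)" using lw hw by linarith
  then have "l ?w \<le> - (1 - 100 * e) * h ?w" by (simp add: algebra_simps)
  then show "good (100 * e) ?w" using w \<open>B \<le> 11 * h ?w\<close> B M_pos by (auto simp: good_def)
qed

end

section \<open>A chain of good points\<close>

text \<open>Successive good points, each chosen by \<open>next_good\<close>.\<close>

locale chain = scale +
  fixes x :: "nat \<Rightarrow> real ^ 3"
  assumes x_good: "good e (x j)"
    and x_up: "h (x (Suc j)) \<le> \<sigma> * h (x j)"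
    and x_grow: "(1 + 900 * e) * h (x j) \<le> h (x (Suc j))"
    and x_start: "100 * M \<le> h (x 0)"
begin

abbreviation n :: "nat \<Rightarrow> real" where "n j \<equiv> h (x j)"

lemma x_good_100: "good (100 * e) (x j)"
  using good_100 x_good by blast

lemma x_int: "x j \<in> int_points"
  using good_int x_good by blast

lemma n_pos: "0 < n j"
  using good_pos x_good by blast

lemma en_pos: "0 < e * n j"
  using e_pos n_pos by simp

lemma en_small: "e * n j \<le> n j / 1000000"
  using eh_small n_pos less_imp_le by blast

lemma n_Suc_grow: "n j + 900 * (e * n j) \<le> n (Suc j)"
  using x_grow[of j] by (simp add: algebra_simps)

lemma n_strict_mono: "strict_mono n"
  unfolding strict_mono_Suc_iff
proof
  show "n j < n (Suc j)" for j using n_Suc_grow[of j] en_pos[of j] by linarith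
qed

lemma n_less_iff: "n i < n j \<longleftrightarrow> i < j"
  by (rule strict_mono_less[OF n_strict_mono])

lemma n_le_iff: "n i \<le> n j \<longleftrightarrow> i \<le> j"
  by (rule strict_mono_less_eq[OF n_strict_mono])

lemma n_large: "100 * M \<le> n j"
  using x_start n_le_iff[of 0 j] by linarith

lemma n_up: "n (Suc j) \<le> s * n j"
proof -
  have "\<sigma> * n j \<le> s * n j" using sigma e_pos n_pos[of j] by (intro mult_right_mono) auto
  then show ?thesis using x_up[of j] by linarith
qed

lemma n_up': "n (Suc j) \<le> 17321/10000 * n j"
proof -
  have "s * n j \<le> 17321/10000 * n j" using s_lt e_pos n_pos[of j] by (intro mult_right_mono) auto
  then show ?thesis using n_up[of j] by linarith
qed

lemma x_indep: "cross3 (x j) (x (Suc j)) \<noteq> 0"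
proof
  assume "cross3 (x j) (x (Suc j)) = 0"
  then have "cross3 (x (Suc j)) (x j) = 0" by (subst cross_skew) simp
  then have "n (Suc j) \<le> n j + 60 * (e * n j)"
    by (intro proportional_height x_good_100)
  then show False using n_Suc_grow[of j] en_pos[of j] by linarith
qed

lemma n_spacing: "n j \<le> (s - 1 + 101 * e) * n (Suc j)"
  using n_le_iff by (intro spacing x_good_100 x_indep) simp

lemma n_spacing': "n j \<le> 7321/10000 * n (Suc j)"
  using n_le_iff by (intro spacing_numeric x_good_100 x_indep) simp

lemma n_unbounded: "\<exists>j. H < n j"
proof -
  have *: "n 0 + real j * (n 0 / 10) \<le> n j" for j
  proof (induction j)
    case (Suc j)
    have "n 0 \<le> n j" by (simp add: n_le_iff)
    then have "n j + n 0 / 10 \<le> n (Suc j)" using n_spacing'[of j] n_pos[of j] by linarith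
    then show ?case using Suc by (simp add: field_simps)
  qed simp
  obtain j :: nat where "H < real j * (n 0 / 10)"
    using ex_less_of_nat_mult[of "n 0 / 10" H] n_pos[of 0] by auto
  then show ?thesis using *[of j] n_pos[of 0] by (intro exI[of _ j]) linarith
qed

lemma bracket:
  assumes "n i \<le> t"
  obtains j where "i \<le> j" "n j \<le> t" "t < n (Suc j)"
proof -
  define J where "J = (LEAST j. t < n j)"
  obtain j0 where "t < n j0" using n_unbounded by blast
  then have J: "t < n J" unfolding J_def by (rule LeastI)
  then have "i < J" using assms n_less_iff[of i J] by linarith
  then obtain j where j: "J = Suc j" "i \<le> j" by (cases J) auto
  have "\<not> t < n j" using not_less_Least[of j "\<lambda>j. t < n j"] j by (simp add: J_def)
  then show ?thesis using that j J by auto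
qed

text \<open>A good point \<open>w\<close> between \<open>x\<^sub>j\<close> and \<open>x\<^sub>j\<^sub>+\<^sub>1\<close> and independent of both would force
\<open>n\<^sub>j\<^sub>+\<^sub>1 \<ge> n\<^sub>j / (s - 1)\<^sup>2 > s n\<^sub>j\<close>.\<close>

lemma proportional_member:
  assumes w: "good (100 * e) w" and "n 0 \<le> h w"
  obtains m where "cross3 w (x m) = 0"
    "h w \<le> n m + 60 * (e * n m)" "n m \<le> h w + 60 * (e * h w)"
proof -
  obtain j where j: "n j \<le> h w" "h w < n (Suc j)" using bracket[OF assms(2)] by blast
  have "\<exists>m. cross3 w (x m) = 0"
  proof (rule ccontr)
    assume "\<nexists>m. cross3 w (x m) = 0"
    then have nz: "cross3 w (x m) \<noteq> 0" for m by blast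
    have "n j \<le> 7321/10000 * h w"
    proof (intro spacing_numeric x_good_100 w j)
      show "cross3 (x j) w \<noteq> 0" using nz[of j] cross_skew[of "x j" w] by simp
    qed
    moreover have "h w \<le> 7321/10000 * n (Suc j)"
      using j nz by (intro spacing_numeric x_good_100 w) auto
    ultimately show False using n_up'[of j] n_pos[of j] by linarith
  qed
  then obtain m where m: "cross3 w (x m) = 0" by blast
  then have m': "cross3 (x m) w = 0" using cross_skew[of "x m" w] by simp
  show ?thesis
    using that[OF m] proportional_height[OF w x_good_100 m] proportional_height[OF x_good_100 w m']
    by blast
qed

text \<open>On the logarithmic scale this point is the mirror image of \<open>x\<^sub>j\<^sub>+\<^sub>1\<close> in \<open>x\<^sub>j\<close>.\<close>

definition reflected :: "nat \<Rightarrow> real ^ 3" where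
  "reflected j = sandwich (x j) (x (Suc j)) (x j)"

lemma reflected_exists:
  assumes "5 \<le> j"
  obtains m where "m < j" "cross3 (reflected j) (x m) = 0"
    "good (100 * e) (reflected j)"
    "\<bar>h (reflected j) - n m\<bar> \<le> 60 * (e * n j)"
    "\<bar>n m - (2 * n j - n (Suc j))\<bar> \<le> 100 * (e * n j)"
proof -
  obtain i where i: "j = Suc (Suc (Suc (Suc (Suc i))))"
    using le_Suc_ex[OF assms] by (auto simp: eval_nat_numeral)
  have n0: "n 0 \<le> n i" by (simp add: n_le_iff)
  \<comment> \<open>Five steps of the chain suffice for the mirror image not to fall below \<open>x\<^sub>0\<close>, since \<open>1/4 < 2 - s\<close>.\<close>
  have nj: "4 * n 0 \<le> n j"
    using n0 n_spacing'[of i] n_spacing'[of "Suc i"] n_spacing'[of "Suc (Suc i)"]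
      n_spacing'[of "Suc (Suc (Suc i))"] n_spacing'[of "Suc (Suc (Suc (Suc i)))"] n_pos[of 0]
    unfolding i by linarith
  note up = n_up'[of j] and sp = n_spacing'[of j] and pos = n_pos[of j]
  have le: "n j \<le> n (Suc j)" by (simp add: n_le_iff)
  have en: "e * n (Suc j) \<le> 17321/10000 * (e * n j)"
    using mult_left_mono[OF up, of e] e_pos by simp
  have B: "n (Suc j) \<le> 10 * n j + 10 * n j - 10 * n (Suc j)" using up pos by linarith
  note g = sandwich_good[OF x_good x_good x_good det3_repeat(2) le order_refl le B n_large, folded reflected_def]
  have h1: "\<bar>h (reflected j) - (2 * n j - n (Suc j))\<bar> \<le> 7 * (e * n j)"
    using g(2) en en_pos[of j] by linarith
  have "n 0 \<le> h (reflected j)"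
    using h1 up nj en_small[of j] pos by linarith
  then obtain m where m: "cross3 (reflected j) (x m) = 0"
    "h (reflected j) \<le> n m + 60 * (e * n m)" "n m \<le> h (reflected j) + 60 * (e * h (reflected j))"
    using proportional_member[OF g(1)] by blast
  have hj: "h (reflected j) \<le> 9/10 * n j"
    using h1 sp pos en_small[of j] by linarith
  then have "e * h (reflected j) \<le> e * (9/10 * n j)" using e_pos by (intro mult_left_mono) auto
  then have m3: "n m \<le> h (reflected j) + 54 * (e * n j)" using m(3) by linarith
  then have "n m < n j" using hj pos en_small[of j] by linarith
  then have mj: "m < j" by (simp add: n_less_iff)
  have "e * n m \<le> e * n j" using \<open>n m < n j\<close> e_pos by simp
  then have close: "\<bar>h (reflected j) - n m\<bar> \<le> 60 * (e * n j)"
    using m(2) m3 en_pos[of j] by linarith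
  moreover have "\<bar>n m - (2 * n j - n (Suc j))\<bar> \<le> 100 * (e * n j)"
    using close h1 en_pos[of j] by linarith
  ultimately show ?thesis using that mj m(1) g(1) by blast
qed

text \<open>It vanishes exactly when three consecutive members of the chain are coplanar.\<close>

definition \<Delta> :: "nat \<Rightarrow> real" where
  "\<Delta> j = det3 (x j) (x (Suc j)) (x (Suc (Suc j)))"

text \<open>For coplanar points \<open>x\<^sub>j adj(x\<^sub>j\<^sub>+\<^sub>1) x\<^sub>j\<^sub>+\<^sub>2\<close> is symmetric, hence good. Its size \<open>n\<^sub>j - n\<^sub>j\<^sub>+\<^sub>1 + n\<^sub>j\<^sub>+\<^sub>2\<close>
lies strictly between \<open>n\<^sub>j\<close> and \<open>n\<^sub>j\<^sub>+\<^sub>2\<close>, so it must be \<open>n\<^sub>j\<^sub>+\<^sub>1\<close>.\<close>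

lemma Delta_zero:
  assumes "\<Delta> j = 0"
  shows "\<bar>n (Suc (Suc j)) - 2 * n (Suc j) + n j\<bar> \<le> 200 * (e * n (Suc j))"
proof -
  let ?w = "sandwich (x j) (x (Suc j)) (x (Suc (Suc j)))"
  have le: "n j \<le> n (Suc j)" "n (Suc j) \<le> n (Suc (Suc j))" by (simp_all add: n_le_iff)
  note sp = n_spacing'[of j] n_spacing'[of "Suc j"] and up = n_up'[of j] n_up'[of "Suc j"]
  note pos = n_pos[of j] n_pos[of "Suc j"]
  have en: "e * n (Suc (Suc j)) \<le> 17321/10000 * (e * n (Suc j))"
    using mult_left_mono[OF up(2), of e] e_pos by simp
  have B: "n (Suc (Suc j)) \<le> 10 * n j + 10 * n (Suc (Suc j)) - 10 * n (Suc j)"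
    using sp up pos by linarith
  note g = sandwich_good[OF x_good x_good x_good assms[unfolded \<Delta>_def] le order_refl B n_large]
  let ?s = "n j + n (Suc (Suc j)) - n (Suc j)"
  have h1: "\<bar>h ?w - ?s\<bar> \<le> 7 * (e * n (Suc j))"
    using g(2) en en_pos[of "Suc j"] by linarith
  have n0: "n 0 \<le> n j" by (simp add: n_le_iff)
  then have "n 0 \<le> h ?w" using h1 sp(2) pos en_small[of "Suc j"] by linarith
  then obtain m where m: "cross3 ?w (x m) = 0"
    "h ?w \<le> n m + 60 * (e * n m)" "n m \<le> h ?w + 60 * (e * h ?w)"
    using proportional_member[OF g(1)] by blast
  have hw: "h ?w \<le> n (Suc (Suc j))" using h1 sp(1) pos en_small[of "Suc j"] by linarith
  then have "e * h ?w \<le> e * n (Suc (Suc j))" using e_pos by (intro mult_left_mono) auto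
  then have m3: "n m \<le> h ?w + 104 * (e * n (Suc j))" using m(3) en en_pos[of "Suc j"] by linarith
  have "n m < n (Suc (Suc j))"
    using m3 h1 sp(1) pos en_small[of "Suc j"] by linarith
  then have "m \<le> Suc j" by (simp add: n_less_iff)
  moreover have "\<not> m \<le> j"
  proof
    assume "m \<le> j"
    then have "n m \<le> n j" by (simp add: n_le_iff)
    moreover have "e * n m \<le> n m / 1000000" by (rule en_small)
    ultimately show False using m(2) h1 sp pos en_small[of "Suc j"] by linarith
  qed
  ultimately have "m = Suc j" by simp
  then show ?thesis using m(2) m3 h1 en_pos[of "Suc j"] by auto
qed

text \<open>The determinant is an integer of size at most about \<open>exp (n\<^sub>j\<^sub>+\<^sub>2 - n\<^sub>j - n\<^sub>j\<^sub>+\<^sub>1)\<close>.\<close>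

lemma Delta_nonzero:
  assumes "\<Delta> j \<noteq> 0"
  shows "n j + n (Suc j) \<le> n (Suc (Suc j)) + 10 * (e * n (Suc j))"
proof (rule ccontr)
  assume neg: "\<not> ?thesis"
  note l = good_l[OF x_good[of j]] good_l[OF x_good[of "Suc j"]] good_l[OF x_good[of "Suc (Suc j)"]]
  note up = n_up'[of j] n_up'[of "Suc j"] and pos = n_pos[of j] n_pos[of "Suc j"]
  have le: "n j \<le> n (Suc j)" "n (Suc j) \<le> n (Suc (Suc j))" by (simp_all add: n_le_iff)
  have e0: "e * n j \<le> e * n (Suc j)" using le e_pos by simp
  have c1: "c \<le> e * n (Suc j)" using good_M[OF x_good[of "Suc j"]] by (rule c_le_eh)
  note sm = en_small[of "Suc j"] en_small[of "Suc (Suc j)"] en_pos[of "Suc j"]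
  have "\<Delta> j = 0" unfolding \<Delta>_def
  proof (rule det3_eq_0[OF x_int x_int x_int])
    show "c + n j + l (x (Suc j)) + l (x (Suc (Suc j))) < 0"
      using l c1 sm le pos by linarith
    show "c + n (Suc j) + l (x j) + l (x (Suc (Suc j))) < 0"
      using l c1 sm le pos e0 n_spacing'[of "Suc j"] by linarith
    show "c + n (Suc (Suc j)) + l (x j) + l (x (Suc j)) < 0"
      using l c1 sm le pos e0 neg by linarith
  qed
  with assms show False by simp
qed

text \<open>By \<open>sandwich_self\<close>, replacing \<open>x\<^sub>j\<^sub>+\<^sub>1\<close> by the mirror image changes a determinant with \<open>x\<^sub>j\<close> by the
factor \<open>- qdet (x\<^sub>j)\<close>; replacing the mirror image by the proportional member \<open>x\<^sub>m\<close> changes it by a factor that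
is close to \<open>1\<close> on the logarithmic scale.\<close>

lemma reflected_det:
  assumes "good (100 * e) (reflected j)" "cross3 (reflected j) (x m) = 0" "\<bar>h (reflected j) - n m\<bar> \<le> 60 * (e * n j)"
  shows "\<bar>det3 g (x j) (x (Suc j))\<bar> \<le> exp (60 * (e * n j)) * \<bar>det3 g (x j) (x m)\<bar>"
    and "det3 g (x j) (x m) \<noteq> 0 \<Longrightarrow> det3 g (x j) (x (Suc j)) \<noteq> 0"
proof -
  obtain \<rho> where \<rho>: "reflected j = \<rho> *\<^sub>R x m" "ln \<bar>\<rho>\<bar> = h (reflected j) - n m" "\<rho> \<noteq> 0"
    using proportional[OF good_int[OF assms(1)] x_int assms(2)] by metis
  have "\<bar>\<rho>\<bar> = exp (h (reflected j) - n m)" using \<rho> by (metis exp_ln zero_less_abs_iff)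
  also have "\<dots> \<le> exp (60 * (e * n j))" using assms(3) by simp
  finally have \<rho>le: "\<bar>\<rho>\<bar> \<le> exp (60 * (e * n j))" .
  have "det3 g (x j) (\<rho> *\<^sub>R x m) = \<rho> * det3 g (x j) (x m)"
    by (simp add: det3_expand algebra_simps)
  then have eq: "\<rho> * det3 g (x j) (x m) = - qdet (x j) * det3 g (x j) (x (Suc j))"
    using det3_sandwich_self[of g "x j" "x (Suc j)"] \<rho>(1) by (simp add: reflected_def)
  have "1 \<le> \<bar>qdet (x j)\<bar>" using good_qdet[OF x_good_100] x_int by (intro Ints_nonzero_abs_ge1 qdet_Ints)
  then have "1 * \<bar>det3 g (x j) (x (Suc j))\<bar> \<le> \<bar>qdet (x j)\<bar> * \<bar>det3 g (x j) (x (Suc j))\<bar>"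
    by (intro mult_right_mono) auto
  also have "\<dots> = \<bar>\<rho>\<bar> * \<bar>det3 g (x j) (x m)\<bar>" using eq by (metis abs_minus_cancel abs_mult)
  also have "\<dots> \<le> exp (60 * (e * n j)) * \<bar>det3 g (x j) (x m)\<bar>" using \<rho>le by (intro mult_right_mono) auto
  finally show "\<bar>det3 g (x j) (x (Suc j))\<bar> \<le> exp (60 * (e * n j)) * \<bar>det3 g (x j) (x m)\<bar>" by simp
  show "det3 g (x j) (x (Suc j)) \<noteq> 0" if "det3 g (x j) (x m) \<noteq> 0"
    using eq that \<rho>(3) by auto
qed

end

section \<open>Recurrence of the consecutive determinants\<close>

context scale
begin

text \<open>Up to errors of order \<open>e P\<close>: the hypotheses give \<open>b \<ge> a + P\<close> and \<open>m \<ge> (2 - s) b\<close>, so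
\<open>a \<ge> P + m\<close> yields \<open>(s - 1) a \<ge> (3 - s) P\<close>. With \<open>a \<le> s P\<close> this becomes \<open>s\<^sup>2 \<ge> 3\<close>.\<close>

lemma growth_contradiction_1:
  assumes "0 < P" "a \<le> s * P" "b \<le> 17321/10000 * a" "a + P \<le> b + 10 * (e * a)"
    and "2 * b - s * b \<le> m + 100 * (e * b)" "P + m \<le> a + 10 * (e * P)"
  shows False
proof -
  have a_le: "a \<le> 17321/10000 * P"
    using assms(1) s_lt e_pos by (intro order_trans[OF assms(2)] mult_right_mono) auto
  have ea: "e * a \<le> 17321/10000 * (e * P)" using mult_left_mono[OF a_le, of e] e_pos by simp
  have eb: "e * b \<le> 17321/10000 * (e * a)" using mult_left_mono[OF assms(3), of e] e_pos by simp
  have eP: "0 < e * P" "e * P \<le> P / 1000000" using e_pos assms(1) eh_small by simp_all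
  have "0 < a" using assms(3,4) eP ea assms(1) by linarith
  then have ea0: "0 \<le> e * a" using e_pos by simp
  have f1: "(2 - s) * (a + P - 10 * (e * a)) \<le> (2 - s) * b"
    using assms(4) s_lt e_pos by (intro mult_left_mono) auto
  have f2: "(s - 1) * a \<le> (s - 1) * (s * P)"
    using assms(2) s_gt by (intro mult_left_mono) auto
  have f3: "s\<^sup>2 * P \<le> (3 - 1000000 * e) * P"
    using s_sq assms(1) by (intro mult_right_mono) auto
  have f4: "172/100 * (e * a) \<le> s * (e * a)" using s_gt ea0 by (intro mult_right_mono) auto
  have f1': "2 * a + 2 * P - 20 * (e * a) - s * a - s * P + 10 * (s * (e * a)) \<le> 2 * b - s * b"
    using f1 by (simp add: algebra_simps)
  have f2': "s * a - a \<le> s\<^sup>2 * P - s * P" using f2 by (simp add: algebra_simps power2_eq_square)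
  have f3': "s\<^sup>2 * P \<le> 3 * P - 1000000 * (e * P)" using f3 by (simp add: algebra_simps)
  show False using f1' f2' f3' f4 ea eb eP assms(5,6) by linarith
qed

text \<open>Up to errors of order \<open>e a\<close>: now \<open>2 P - a \<ge> m \<ge> (2 - s) (a + P)\<close> yields \<open>s P \<ge> (3 - s) a\<close>, and with
\<open>P \<le> (s - 1) a\<close> this again becomes \<open>s\<^sup>2 \<ge> 3\<close>.\<close>

lemma growth_contradiction_2:
  assumes "0 < P" "a \<le> 17321/10000 * P" "P \<le> (s - 1 + 101 * e) * a" "b \<le> 17321/10000 * a"
    and "a + P \<le> b + 10 * (e * a)"
    and "2 * b - s * b \<le> m + 100 * (e * b)" "m + a \<le> 2 * P + 200 * (e * P)"
  shows False
proof -
  have ea: "e * a \<le> 17321/10000 * (e * P)" using mult_left_mono[OF assms(2), of e] e_pos by simp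
  have eb: "e * b \<le> 17321/10000 * (e * a)" using mult_left_mono[OF assms(4), of e] e_pos by simp
  have eP: "0 < e * P" "e * P \<le> P / 1000000" using e_pos assms(1) eh_small by simp_all
  have a0: "0 < a" using assms(4,5) eP ea assms(1) by linarith
  then have ea0: "0 < e * a" using e_pos by simp
  have f1: "(2 - s) * (a + P - 10 * (e * a)) \<le> (2 - s) * b"
    using assms(5) s_lt e_pos by (intro mult_left_mono) auto
  have f2: "s * P \<le> s * ((s - 1 + 101 * e) * a)"
    using assms(3) s_gt by (intro mult_left_mono) auto
  have f3: "s\<^sup>2 * a \<le> (3 - 1000000 * e) * a"
    using s_sq a0 by (intro mult_right_mono) auto
  have f4: "172/100 * (e * a) \<le> s * (e * a)" using s_gt ea0 by (intro mult_right_mono) auto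
  have f5: "s * (e * a) \<le> 2 * (e * a)" using s_lt e_pos ea0 by (intro mult_right_mono) auto
  have "(s - 1 + 101 * e) * a \<le> 1 * a" using s_lt e_pos a0 by (intro mult_right_mono) auto
  then have "P \<le> a" using assms(3) by simp
  then have ePa: "e * P \<le> e * a" using e_pos by simp
  have f1': "2 * a + 2 * P - 20 * (e * a) - s * a - s * P + 10 * (s * (e * a)) \<le> 2 * b - s * b"
    using f1 by (simp add: algebra_simps)
  have f2': "s * P \<le> s\<^sup>2 * a - s * a + 101 * (s * (e * a))"
    using f2 by (simp add: algebra_simps power2_eq_square)
  have f3': "s\<^sup>2 * a \<le> 3 * a - 1000000 * (e * a)" using f3 by (simp add: algebra_simps)
  show False using f1' f2' f3' f4 f5 ePa ea0 eb assms(6,7) by linarith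
qed

end

context chain
begin

lemma n_less_factor: "i < j \<Longrightarrow> n i \<le> 7321/10000 * n j"
proof -
  assume "i < j"
  then have "n (Suc i) \<le> n j" by (simp add: n_le_iff)
  then show ?thesis using n_spacing'[of i] by linarith
qed

text \<open>The mirror image of \<open>x\<^sub>j\<^sub>+\<^sub>1\<close> in \<open>x\<^sub>j\<close> is, up to a factor of small logarithm, the member \<open>x\<^sub>m\<close>.\<close>

definition returns :: "nat \<Rightarrow> nat \<Rightarrow> bool" where
  "returns j m \<longleftrightarrow> good (100 * e) (reflected j) \<and> cross3 (reflected j) (x m) = 0
     \<and> \<bar>h (reflected j) - n m\<bar> \<le> 60 * (e * n j)"

lemma returns_exists:
  assumes "5 \<le> j"
  obtains m where "m < j" "returns j m" "\<bar>n m - (2 * n j - n (Suc j))\<bar> \<le> 100 * (e * n j)"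
  using reflected_exists[OF assms] unfolding returns_def by metis

lemma returns_det:
  assumes "returns j m"
  shows "\<bar>det3 g (x j) (x (Suc j))\<bar> \<le> exp (60 * (e * n j)) * \<bar>det3 g (x j) (x m)\<bar>"
    and "det3 g (x j) (x m) \<noteq> 0 \<Longrightarrow> det3 g (x j) (x (Suc j)) \<noteq> 0"
  using reflected_det assms unfolding returns_def by blast+

text \<open>The size \<open>2 n\<^sub>j\<^sub>+\<^sub>1 - n\<^sub>j\<^sub>+\<^sub>2\<close> of the mirror image is \<open>n\<^sub>j\<close> by \<open>Delta_zero\<close>.\<close>

lemma returns_coplanar:
  assumes "\<Delta> j = 0" "4 \<le> j" shows "returns (Suc j) j"
proof -
  obtain m where m: "returns (Suc j) m" "m < Suc j"
    "\<bar>n m - (2 * n (Suc j) - n (Suc (Suc j)))\<bar> \<le> 100 * (e * n (Suc j))"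
    using returns_exists[of "Suc j"] assms(2) by auto
  have "\<not> m < j"
  proof
    assume "m < j"
    then have "n m \<le> 7321/10000 * n j" by (rule n_less_factor)
    then show False
      using m(3) Delta_zero[OF assms(1)] en_small[of "Suc j"] n_up'[of j] n_pos[of j] by linarith
  qed
  then have "m = j" using m(2) by simp
  then show ?thesis using m(1) by simp
qed

text \<open>Two consecutive vanishing determinants would put four members of the chain in arithmetic
progression on the logarithmic scale, and \<open>p, p + q, p + 2 q, p + 3 q\<close> cannot have all ratios
between \<open>1 / (s - 1)\<close> and \<open>s\<close>.\<close>

lemma Delta_Suc_nonzero: assumes "\<Delta> j = 0" shows "\<Delta> (Suc j) \<noteq> 0"
proof
  assume "\<Delta> (Suc j) = 0"
  from Delta_zero[OF this] Delta_zero[OF assms] show False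
    using n_spacing'[of "Suc (Suc j)"] n_spacing'[of j] n_up'[of j] n_up'[of "Suc j"] n_pos[of j] n_pos[of "Suc j"]
      en_small[of "Suc j"] en_small[of "Suc (Suc j)"] by linarith
qed

text \<open>The mirror image has size at least \<open>(2 - s) n\<^sub>j\<^sub>+\<^sub>3\<close>, too large for the members before \<open>x\<^sub>j\<close>, and at
most \<open>n\<^sub>j\<^sub>+\<^sub>3 - n\<^sub>j\<^sub>+\<^sub>2\<close>, too small for \<open>x\<^sub>j\<^sub>+\<^sub>2\<close>. The member \<open>x\<^sub>j\<close> is the delicate case. It is excluded by the two
growth contradictions, according to whether \<open>x\<^sub>j\<close>, \<open>x\<^sub>j\<^sub>+\<^sub>1\<close>, \<open>x\<^sub>j\<^sub>+\<^sub>2\<close> are coplanar.\<close>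

lemma returns_noncoplanar:
  assumes "\<Delta> (Suc j) \<noteq> 0" "\<Delta> (Suc (Suc j)) \<noteq> 0" "2 \<le> j"
  shows "returns (Suc (Suc (Suc j))) (Suc j)"
proof -
  let ?j1 = "Suc j" and ?j2 = "Suc (Suc j)" and ?j3 = "Suc (Suc (Suc j))"
  obtain m where m: "returns ?j3 m" "m < ?j3"
    "\<bar>n m - (2 * n ?j3 - n (Suc ?j3))\<bar> \<le> 100 * (e * n ?j3)"
    using returns_exists[of ?j3] assms(3) by auto
  note up = n_up'[of ?j1] n_up'[of ?j2] n_up'[of ?j3] and sp = n_spacing'[of ?j1] n_spacing'[of ?j2]
  note pos = n_pos[of ?j1] n_pos[of ?j2] n_pos[of ?j3]
  note sm = en_small[of ?j2] en_small[of ?j3]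
  note ex1 = Delta_nonzero[OF assms(1)] and ex2 = Delta_nonzero[OF assms(2)]
  have low: "2 * n ?j3 - s * n ?j3 \<le> n m + 100 * (e * n ?j3)"
    using m(3) n_up[of ?j3] by linarith
  have "m \<noteq> ?j2"
  proof
    assume "m = ?j2"
    then show False using m(3)[unfolded \<open>m = ?j2\<close>] ex2 up pos sm by linarith
  qed
  moreover have "\<not> m < j"
  proof
    assume "m < j"
    then have "n m \<le> 7321/10000 * n j" by (rule n_less_factor)
    then show False using m(3) ex1 up sp pos sm n_spacing'[of j] by linarith
  qed
  moreover have "m \<noteq> j"
  proof
    assume mj: "m = j"
    show False
    proof (cases "\<Delta> j = 0")
      case False
      show False
        by (rule growth_contradiction_1[OF pos(1) n_up up(2) _ low])
          (use ex1 Delta_nonzero[OF False] mj in \<open>simp_all add: add.commute\<close>)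
    next
      case True
      have "n m + n ?j2 \<le> 2 * n ?j1 + 200 * (e * n ?j1)"
        unfolding mj using Delta_zero[OF True] by linarith
      moreover have "n ?j2 + n ?j1 \<le> n ?j3 + 10 * (e * n ?j2)" using ex1 by linarith
      ultimately show False
        by (intro growth_contradiction_2[OF pos(1) up(1) n_spacing up(2) _ low])
    qed
  qed
  ultimately have "m = ?j1" using m(2) by linarith
  then show ?thesis using m(1) by simp
qed

text \<open>After a coplanar triple the mirror image jumps back one member further. Here plain numerical
bounds suffice, because \<open>n\<^sub>j\<^sub>+\<^sub>3\<close> is about \<open>2 n\<^sub>j\<^sub>+\<^sub>2 - n\<^sub>j\<^sub>+\<^sub>1\<close>.\<close>

lemma returns_after_coplanar:
  assumes "\<Delta> (Suc j) = 0" "2 \<le> j"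
  shows "returns (Suc (Suc (Suc j))) j"
proof -
  let ?j1 = "Suc j" and ?j2 = "Suc (Suc j)" and ?j3 = "Suc (Suc (Suc j))"
  obtain m where m: "returns ?j3 m" "m < ?j3"
    "\<bar>n m - (2 * n ?j3 - n (Suc ?j3))\<bar> \<le> 100 * (e * n ?j3)"
    using returns_exists[of ?j3] assms(2) by auto
  note up = n_up'[of ?j1] n_up'[of ?j2] n_up'[of ?j3] and sp = n_spacing'[of ?j1] n_spacing'[of ?j2]
  note pos = n_pos[of ?j1] n_pos[of ?j2] n_pos[of ?j3]
  note sm = en_small[of ?j2] en_small[of ?j3]
  note ex = Delta_nonzero[OF Delta_Suc_nonzero[OF assms(1)]] and z = Delta_zero[OF assms(1)]
  have "m \<noteq> ?j2" "m \<noteq> ?j1" using m(3) ex z up sp pos sm by (auto; linarith)+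
  moreover have "\<not> m < j"
  proof
    assume "m < j"
    then have "n m \<le> 7321/10000 * n j" by (rule n_less_factor)
    then show False using m(3) z up sp pos sm n_spacing'[of j] by linarith
  qed
  ultimately have "m = j" using m(2) by linarith
  then show ?thesis using m(1) by simp
qed

text \<open>Replace \<open>x\<^sub>j\<^sub>+\<^sub>4\<close> by the member to which its mirror image returns. If the previous triple is not
coplanar, this is \<open>x\<^sub>j\<^sub>+\<^sub>1\<close>, which gives the previous determinant. If it is coplanar, one more replacement, of \<open>x\<^sub>j\<^sub>+\<^sub>3\<close> by
\<open>x\<^sub>j\<^sub>+\<^sub>1\<close>, leads to the determinant before it.\<close>

lemma Delta_recurrence:
  assumes "\<Delta> (Suc (Suc j)) \<noteq> 0" "3 \<le> j"
  shows "\<bar>\<Delta> (Suc (Suc j))\<bar> \<le> exp (60 * (e * n (Suc (Suc (Suc j))))) * \<bar>\<Delta> (Suc j)\<bar> \<and> \<Delta> (Suc j) \<noteq> 0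
    \<or> \<bar>\<Delta> (Suc (Suc j))\<bar> \<le> exp (60 * (e * n (Suc (Suc (Suc j))))) *
         (exp (60 * (e * n (Suc (Suc j)))) * \<bar>\<Delta> j\<bar>) \<and> \<Delta> j \<noteq> 0"
proof (cases "\<Delta> (Suc j) = 0")
  case False
  have "\<bar>\<Delta> (Suc (Suc j))\<bar> \<le> exp (60 * (e * n (Suc (Suc (Suc j)))))
      * \<bar>det3 (x (Suc (Suc j))) (x (Suc (Suc (Suc j)))) (x (Suc j))\<bar>"
    unfolding \<Delta>_def[of "Suc (Suc j)"]
    using returns_det(1)[OF returns_noncoplanar[OF False assms(1)]] assms(2) by simp
  also have "det3 (x (Suc (Suc j))) (x (Suc (Suc (Suc j)))) (x (Suc j)) = \<Delta> (Suc j)"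
    unfolding \<Delta>_def by (rule det3_rotate[symmetric])
  finally show ?thesis using False by blast
next
  case True
  have "\<bar>\<Delta> (Suc (Suc j))\<bar> \<le> exp (60 * (e * n (Suc (Suc (Suc j)))))
      * \<bar>det3 (x (Suc (Suc j))) (x (Suc (Suc (Suc j)))) (x j)\<bar>"
    unfolding \<Delta>_def[of "Suc (Suc j)"]
    using returns_det(1)[OF returns_after_coplanar[OF True]] assms(2) by simp
  also have "det3 (x (Suc (Suc j))) (x (Suc (Suc (Suc j)))) (x j)
      = det3 (x j) (x (Suc (Suc j))) (x (Suc (Suc (Suc j))))"
    by (rule det3_rotate[symmetric])
  also have "\<bar>\<dots>\<bar> \<le> exp (60 * (e * n (Suc (Suc j)))) * \<bar>det3 (x j) (x (Suc (Suc j))) (x (Suc j))\<bar>"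
    using returns_det(1)[OF returns_coplanar[OF True]] assms(2) by simp
  also have "\<bar>det3 (x j) (x (Suc (Suc j))) (x (Suc j))\<bar> = \<bar>\<Delta> j\<bar>"
    unfolding \<Delta>_def by (subst det3_swap) simp
  finally have "\<bar>\<Delta> (Suc (Suc j))\<bar> \<le> exp (60 * (e * n (Suc (Suc (Suc j))))) *
         (exp (60 * (e * n (Suc (Suc j)))) * \<bar>\<Delta> j\<bar>)" by simp
  moreover have "\<Delta> j \<noteq> 0" using Delta_Suc_nonzero[of j] True by auto
  ultimately show ?thesis by blast
qed

text \<open>The errors in the recurrence add up to a multiple of \<open>e\<close> times the last size, because the sizes
grow geometrically.\<close>

lemma Delta_bound: "\<exists>B. \<forall>j. \<bar>\<Delta> j\<bar> \<le> exp (B + 1000 * (e * n (Suc j)))"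
proof -
  define B where "B = (\<Sum>j<6. \<bar>\<Delta> j\<bar>)"
  have "\<bar>\<Delta> j\<bar> \<le> exp (B + 1000 * (e * n (Suc j)))" for j
  proof (induction j rule: less_induct)
    case (less j)
    consider "\<Delta> j = 0" | "\<Delta> j \<noteq> 0" "j < 6" | "\<Delta> j \<noteq> 0" "6 \<le> j" by linarith
    then show ?case
    proof cases
      case 2
      have "\<bar>\<Delta> j\<bar> \<le> B" unfolding B_def using 2 by (intro member_le_sum) auto
      also have "B \<le> exp B" using exp_ge_add_one_self[of B] by linarith
      also have "\<dots> \<le> exp (B + 1000 * (e * n (Suc j)))" using en_pos[of "Suc j"] by simp
      finally show ?thesis .
    next
      case 3
      obtain i where i: "j = Suc (Suc i)" "3 \<le> i"
        using le_Suc_ex[OF 3(2)] by (auto simp: eval_nat_numeral)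
      have e1: "e * n (Suc (Suc i)) \<le> 7321/10000 * (e * n (Suc (Suc (Suc i))))"
        and e0: "e * n (Suc i) \<le> 7321/10000 * (e * n (Suc (Suc i)))"
        using mult_left_mono[OF n_spacing'[of "Suc (Suc i)"], of e]
          mult_left_mono[OF n_spacing'[of "Suc i"], of e] e_pos by simp_all
      have ep: "0 < e * n (Suc (Suc (Suc i)))" by (rule en_pos)
      from Delta_recurrence[of i] 3(1) i
      consider "\<bar>\<Delta> j\<bar> \<le> exp (60 * (e * n (Suc j))) * \<bar>\<Delta> (Suc i)\<bar>"
        | "\<bar>\<Delta> j\<bar> \<le> exp (60 * (e * n (Suc j))) * (exp (60 * (e * n j)) * \<bar>\<Delta> i\<bar>)"
        by blast
      then show ?thesis
      proof cases
        case 1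
        note 1
        also have "exp (60 * (e * n (Suc j))) * \<bar>\<Delta> (Suc i)\<bar> \<le> exp (60 * (e * n (Suc j))) * exp (B + 1000 * (e * n (Suc (Suc i))))"
          using less[of "Suc i"] i by (intro mult_left_mono) auto
        also have "\<dots> \<le> exp (B + 1000 * (e * n (Suc j)))"
          unfolding exp_add[symmetric] exp_le_cancel_iff i(1) using e1 ep by linarith
        finally show ?thesis .
      next
        case 2
        note 2
        also have "exp (60 * (e * n (Suc j))) * (exp (60 * (e * n j)) * \<bar>\<Delta> i\<bar>) \<le> exp (60 * (e * n (Suc j))) * (exp (60 * (e * n j)) * exp (B + 1000 * (e * n (Suc i))))"
          using less[of i] i by (intro mult_left_mono) auto
        also have "\<dots> \<le> exp (B + 1000 * (e * n (Suc j)))"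
          unfolding exp_add[symmetric] exp_le_cancel_iff i(1) using e1 e0 ep by linarith
        finally show ?thesis .
      qed
    qed simp
  qed
  then show ?thesis by blast
qed

text \<open>The determinant bounds the index of the group generated by \<open>x\<^sub>j\<close> and \<open>x\<^sub>j\<^sub>+\<^sub>1\<close> in the integer points of
their plane. The point \<open>g\<close> is \<open>x\<^sub>j\<^sub>-\<^sub>1\<close>, or \<open>x\<^sub>j\<^sub>-\<^sub>2\<close> if \<open>x\<^sub>j\<^sub>-\<^sub>1\<close> lies in that plane.\<close>

lemma transversal_exists:
  "\<exists>B. \<forall>j\<ge>10. \<exists>g \<in> int_points. det3 g (x j) (x (Suc j)) \<noteq> 0 \<and>
     \<bar>det3 g (x j) (x (Suc j))\<bar> \<le> exp (B + 2000 * (e * n j))"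
proof -
  obtain B where B: "\<And>j. \<bar>\<Delta> j\<bar> \<le> exp (B + 1000 * (e * n (Suc j)))" using Delta_bound by blast
  have "\<exists>g \<in> int_points. det3 g (x j) (x (Suc j)) \<noteq> 0 \<and>
     \<bar>det3 g (x j) (x (Suc j))\<bar> \<le> exp (B + 2000 * (e * n j))" if j10: "10 \<le> j" for j
  proof -
    obtain i where i: "j = Suc (Suc i)" "8 \<le> i"
      using le_Suc_ex[OF j10] by (auto simp: eval_nat_numeral)
    have ep: "0 < e * n j" by (rule en_pos)
    show ?thesis
    proof (cases "\<Delta> (Suc i) = 0")
      case False
      have "\<bar>\<Delta> (Suc i)\<bar> \<le> exp (B + 2000 * (e * n j))"
        using B[of "Suc i"] ep unfolding i(1) by (elim order_trans) simp
      then show ?thesis using False x_int unfolding \<Delta>_def i(1) by blast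
    next
      case True
      have r: "returns (Suc (Suc i)) (Suc i)" using returns_coplanar[OF True] i by simp
      have dD: "\<bar>det3 (x i) (x (Suc (Suc i))) (x (Suc i))\<bar> = \<bar>\<Delta> i\<bar>"
        unfolding \<Delta>_def by (subst det3_swap) simp
      have "\<Delta> i \<noteq> 0" using Delta_Suc_nonzero[of i] True by auto
      then have nz: "det3 (x i) (x j) (x (Suc j)) \<noteq> 0"
        using returns_det(2)[OF r, of "x i"] dD unfolding i(1) by auto
      have "e * n (Suc i) \<le> e * n j" using e_pos n_le_iff i(1) by simp
      then have "60 * (e * n j) + (B + 1000 * (e * n (Suc i))) \<le> B + 2000 * (e * n j)"
        using ep by linarith
      moreover have "\<bar>det3 (x i) (x j) (x (Suc j))\<bar> \<le> exp (60 * (e * n j)) * exp (B + 1000 * (e * n (Suc i)))"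
        using returns_det(1)[OF r, of "x i"] unfolding dD i(1)
        by (rule order_trans) (intro mult_left_mono B, simp)
      ultimately have "\<bar>det3 (x i) (x j) (x (Suc j))\<bar> \<le> exp (B + 2000 * (e * n j))"
        unfolding exp_add[symmetric] by (meson exp_le_cancel_iff order_trans)
      then show ?thesis using nz x_int by blast
    qed
  qed
  then show ?thesis by blast
qed

end

section \<open>Small points are good or dominated by the chain\<close>

lemma cramer3:
  "det3 g u v *\<^sub>R y = det3 y u v *\<^sub>R g + det3 g y v *\<^sub>R u + det3 g u y *\<^sub>R v"
  by (simp add: vec_eq_iff forall_3 det3_expand algebra_simps)

context point_bounds
begin

lemma err_scale: "L (a *\<^sub>R x) = \<bar>a\<bar> * L x"
  by (simp add: err_def cross_mult_left infnorm_mul)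

lemma err_combination_ge: "\<bar>a\<bar> * L x - \<bar>b\<bar> * L y \<le> L (a *\<^sub>R x + b *\<^sub>R y)"
proof -
  have "\<bar>a\<bar> * L x = L ((a *\<^sub>R x + b *\<^sub>R y) + (- b) *\<^sub>R y)" by (simp add: err_scale)
  also have "\<dots> \<le> L (a *\<^sub>R x + b *\<^sub>R y) + L ((- b) *\<^sub>R y)"
    unfolding err_def cross_add_left by (rule infnorm_triangle)
  finally show ?thesis by (simp add: err_scale del: scaleR_minus_left)
qed

lemma infnorm_combination_ge:
  "\<bar>b\<bar> * infnorm y - \<bar>a\<bar> * infnorm x \<le> infnorm (a *\<^sub>R x + b *\<^sub>R (y :: real ^ 3))"
proof -
  have "\<bar>b\<bar> * infnorm y = infnorm ((a *\<^sub>R x + b *\<^sub>R y) + (- a) *\<^sub>R x)" by (simp add: infnorm_mul)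
  also have "\<dots> \<le> infnorm (a *\<^sub>R x + b *\<^sub>R y) + infnorm ((- a) *\<^sub>R x)"
    by (rule infnorm_triangle)
  finally show ?thesis by (simp add: infnorm_mul infnorm_neg del: scaleR_minus_left)
qed

end

context chain
begin

text \<open>By \<open>det3_eq_0\<close> the point \<open>y\<close> lies in the plane of \<open>u = x\<^sub>i\<close> and \<open>v = x\<^sub>i\<^sub>+\<^sub>1\<close>. By Cramer's rule \<open>d y = a u + b v\<close>
with integers \<open>a\<close>, \<open>b\<close> and a small \<open>d\<close>. If \<open>a \<noteq> 0\<close>, then either \<open>a u\<close> dominates the error of \<open>d y\<close>, so that
\<open>L y\<close> is too large, or \<open>b\<close> is so large that \<open>b v\<close> dominates its norm, so that \<open>y\<close> is larger
than \<open>v\<close>. Hence \<open>a = 0\<close>, and \<open>y\<close>, being proportional to \<open>v\<close> and shorter, is at least as good as \<open>v\<close>.\<close>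

lemma small_point_is_member:
  assumes y: "y \<in> int_points" and g: "g \<in> int_points"
    and d: "det3 g (x i) (x (Suc i)) \<noteq> 0" "\<bar>det3 g (x i) (x (Suc i))\<bar> \<le> exp (B + 2000 * (e * n i))"
    and hy: "h y < n (Suc i)" and ly: "l y \<le> - n i - 9000 * (e * n i)"
    and large: "B + 10 \<le> e * n i" "10 \<le> e * n i"
  shows "l y \<le> - (1 - e) * h y"
proof -
  let ?u = "x i" and ?v = "x (Suc i)" and ?d = "det3 g (x i) (x (Suc i))"
  define a b where "a = det3 g y ?v" and "b = det3 g ?u y"
  note lu = good_l[OF x_good[of i]] and lv = good_l[OF x_good[of "Suc i"]]
  note lu2 = good_lower[OF x_good_100[of i]] and lv2 = good_lower[OF x_good_100[of "Suc i"]]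
  note pos = n_pos[of i] n_pos[of "Suc i"] and sm = en_small[of i] en_small[of "Suc i"]
  note up = n_up'[of i] and sp = n_spacing'[of i]
  have c1: "c \<le> e * n i" using good_M[OF x_good[of i]] by (rule c_le_eh)
  have ei: "0 < e * n i" by (rule en_pos)
  have en: "e * n (Suc i) \<le> 17321/10000 * (e * n i)"
    using mult_left_mono[OF up, of e] e_pos by simp
  have "det3 y ?u ?v = 0"
  proof (rule det3_eq_0[OF y x_int x_int])
    show "c + h y + l ?u + l ?v < 0" using c1 hy lu lv sm pos en ei by linarith
    show "c + n i + l y + l ?v < 0" using c1 ly lv sm pos en ei by linarith
    show "c + n (Suc i) + l y + l ?u < 0" using c1 ly lu up sm pos en ei by linarith
  qed
  then have dy: "?d *\<^sub>R y = a *\<^sub>R ?u + b *\<^sub>R ?v"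
    using cramer3[of g ?u ?v y] by (simp add: a_def b_def)
  have err_y: "\<bar>a\<bar> * L ?u - \<bar>b\<bar> * L ?v \<le> \<bar>?d\<bar> * L y"
    using err_combination_ge[of a ?u b ?v] unfolding dy[symmetric] err_scale .
  have inf_y: "\<bar>b\<bar> * infnorm ?v - \<bar>a\<bar> * infnorm ?u \<le> \<bar>?d\<bar> * infnorm y"
    using infnorm_combination_ge[of b ?v a ?u] unfolding dy[symmetric] infnorm_mul .
  have e2: "2 \<le> exp (1 :: real)" using exp_ge_add_one_self[of "1 :: real"] by simp
  have "a = 0"
  proof (rule ccontr)
    assume "a \<noteq> 0"
    then have a1: "1 \<le> \<bar>a\<bar>" unfolding a_def by (intro Ints_nonzero_abs_ge1 det3_Ints g y x_int)
    have half: "exp (z - 1) \<le> exp z / 2" for z :: real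
      using e2 by (simp add: exp_diff divide_simps mult_left_mono)
    show False
    proof (cases "\<bar>b\<bar> * L ?v \<le> \<bar>a\<bar> * L ?u / 2")
      case True
      have "exp (l ?u - 1) \<le> L ?u / 2" using half[of "l ?u"] by (simp add: exp_l x_int)
      also have "\<dots> \<le> \<bar>a\<bar> * L ?u / 2" using mult_right_mono[OF a1, of "L ?u"] err_nonneg by simp
      also have "\<dots> \<le> \<bar>?d\<bar> * L y" using err_y True by linarith
      also have "\<dots> \<le> exp (B + 2000 * (e * n i)) * exp (l y)"
        using d(2) err_nonneg y by (simp add: exp_l mult_right_mono)
      finally have "l ?u - 1 \<le> B + 2000 * (e * n i) + l y" by (simp add: exp_add[symmetric])
      then show False using ly lu2 large by linarith
    next
      case False
      have "\<bar>a\<bar> * infnorm ?u * L ?u \<le> 2 * \<bar>b\<bar> * L ?v * infnorm ?u"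
        using mult_right_mono[OF less_imp_le[OF False[unfolded not_le]], of "infnorm ?u"]
        by (simp add: infnorm_pos_le mult_ac)
      also have "\<dots> = \<bar>b\<bar> * (2 * exp (l ?v + n i))" by (simp add: exp_add exp_h exp_l x_int)
      also have "\<dots> \<le> \<bar>b\<bar> * (exp (n (Suc i) + l ?u) / 2)"
      proof (rule mult_left_mono)
        have "l ?v + n i + 2 \<le> n (Suc i) + l ?u"
          using lv lu2 sp up pos sm large by linarith
        then have "exp (l ?v + n i) \<le> exp (n (Suc i) + l ?u - 1 - 1)" by simp
        also have "\<dots> \<le> exp (n (Suc i) + l ?u - 1) / 2" by (rule half)
        also have "\<dots> \<le> exp (n (Suc i) + l ?u) / 2 / 2"
          by (intro divide_right_mono half) simp
        finally show "2 * exp (l ?v + n i) \<le> exp (n (Suc i) + l ?u) / 2" by simp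
      qed simp
      also have "\<dots> = \<bar>b\<bar> * infnorm ?v / 2 * L ?u" by (simp add: exp_add exp_h exp_l x_int)
      finally have "\<bar>a\<bar> * infnorm ?u \<le> \<bar>b\<bar> * infnorm ?v / 2"
        using err_pos[OF x_int[of i]] by simp
      then have b1: "\<bar>b\<bar> * infnorm ?v / 2 \<le> \<bar>?d\<bar> * infnorm y" using inf_y by linarith
      have "L ?u / 2 \<le> \<bar>b\<bar> * L ?v"
        using False mult_right_mono[OF a1, of "L ?u"] err_nonneg[of ?u] by simp
      moreover have "exp (l ?u - 1) \<le> L ?u / 2" using half[of "l ?u"] by (simp add: exp_l x_int)
      ultimately have "exp (l ?u - 1) \<le> \<bar>b\<bar> * exp (l ?v)" by (simp add: exp_l x_int)
      then have b2: "exp (l ?u - 1 - l ?v) \<le> \<bar>b\<bar>" by (simp add: exp_diff[of _ "l ?v"] divide_simps)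
      have "exp (n (Suc i) - 1) \<le> infnorm ?v / 2" using half[of "n (Suc i)"] by (simp add: exp_h x_int)
      then have "exp (l ?u - 1 - l ?v) * exp (n (Suc i) - 1) \<le> \<bar>b\<bar> * (infnorm ?v / 2)"
        using b2 by (intro mult_mono) auto
      also have "\<dots> \<le> \<bar>?d\<bar> * infnorm y" using b1 by simp
      also have "\<dots> \<le> exp (B + 2000 * (e * n i)) * exp (h y)"
        using mult_right_mono[OF d(2) infnorm_pos_le[of y]] y by (simp add: exp_h)
      finally have "l ?u - 1 - l ?v + (n (Suc i) - 1) \<le> B + 2000 * (e * n i) + h y"
        by (simp add: exp_add[symmetric])
      then show False using hy lu2 lv sp up pos sm large by linarith
    qed
  qed
  then have "?d *\<^sub>R y = b *\<^sub>R ?v" using dy by simp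
  then have "cross3 (?d *\<^sub>R y) ?v = 0" by (simp add: cross_mult_left)
  then have "cross3 y ?v = 0" using d(1) by (simp add: cross_mult_left)
  then obtain \<rho> where \<rho>: "ln \<bar>\<rho>\<bar> = h y - n (Suc i)" "ln \<bar>\<rho>\<bar> = l y - l ?v"
    using proportional[OF y x_int] by metis
  have "e * (n (Suc i) - h y) \<le> 1 * (n (Suc i) - h y)"
    using e_le hy by (intro mult_right_mono) auto
  then have "e * n (Suc i) - e * h y \<le> n (Suc i) - h y" by (simp add: algebra_simps)
  then have "l y \<le> - h y + e * h y" using \<rho> lv hy by linarith
  then show ?thesis by (simp add: algebra_simps)
qed

text \<open>Let \<open>x\<^sub>i\<close> be the last member of the chain of size at most \<open>t\<close>. Either \<open>x\<^sub>i\<close> is itself the required good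
point, or \<open>y\<close> is so much closer to the line of \<open>\<Xi>\<close> that it is good by \<open>small_point_is_member\<close>.\<close>

lemma transfer:
  assumes "0 < \<omega>'" "\<omega>' * (1 + 10000 * e) \<le> \<omega>"
  shows "\<forall>\<^sub>F t in at_top. (\<exists>y \<in> int_points. h y \<le> t \<and> l y \<le> - \<omega> * t) \<longrightarrow>
     (\<exists>w \<in> int_points. h w \<le> t \<and> l w \<le> - \<omega>' * t \<and> l w \<le> - (1 - e) * h w)"
proof -
  obtain B where B: "\<And>j. 10 \<le> j \<Longrightarrow> \<exists>g \<in> int_points. det3 g (x j) (x (Suc j)) \<noteq> 0 \<and>
     \<bar>det3 g (x j) (x (Suc j))\<bar> \<le> exp (B + 2000 * (e * n j))"
    using transversal_exists by blast
  obtain j0 where j0: "(\<bar>B\<bar> + 10) / e < n j0" using n_unbounded by blast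
  define J where "J = max 10 j0"
  have J: "\<bar>B\<bar> + 10 \<le> e * n i" if "J \<le> i" for i
  proof -
    have "n j0 \<le> n i" using that by (simp add: n_le_iff J_def)
    then have "(\<bar>B\<bar> + 10) / e \<le> n i" using j0 by linarith
    then show ?thesis using e_pos by (simp add: divide_le_eq mult.commute)
  qed
  show ?thesis unfolding eventually_at_top_linorder
  proof (intro exI[of _ "n J"] allI impI)
    fix t
    assume t: "n J \<le> t" and "\<exists>y \<in> int_points. h y \<le> t \<and> l y \<le> - \<omega> * t"
    then obtain y where y: "y \<in> int_points" "h y \<le> t" "l y \<le> - \<omega> * t" by blast
    obtain i where i: "J \<le> i" "n i \<le> t" "t < n (Suc i)" using bracket[OF t] by blast
    have t0: "0 < t" using i(2) n_pos[of i] by linarith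
    have "0 \<le> \<omega>' * (10000 * e) * t" using assms(1) e_pos t0 by simp
    moreover have \<omega>t: "\<omega>' * (1 + 10000 * e) * t \<le> \<omega> * t"
      using assms(2) t0 by (intro mult_right_mono) auto
    ultimately have ly': "l y \<le> - \<omega>' * t" using y(3) by (simp add: algebra_simps)
    show "\<exists>w \<in> int_points. h w \<le> t \<and> l w \<le> - \<omega>' * t \<and> l w \<le> - (1 - e) * h w"
    proof (cases "l (x i) \<le> - \<omega>' * t")
      case True
      then show ?thesis using x_good[of i] i(2) x_int by (intro bexI[of _ "x i"]) (auto simp: good_def)
    next
      case False
      then have "(1 - e) * n i \<le> \<omega>' * t" using good_l[OF x_good[of i]] by (simp add: algebra_simps)
      then have "(1 + 10000 * e) * ((1 - e) * n i) \<le> (1 + 10000 * e) * (\<omega>' * t)"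
        using e_pos by (intro mult_left_mono) auto
      also have "\<dots> \<le> \<omega> * t" using \<omega>t by (simp add: mult_ac)
      finally have *: "(1 + 10000 * e) * ((1 - e) * n i) \<le> - l y" using y(3) by simp
      have "e * (e * n i) \<le> 1/1000000 * (e * n i)"
        using e_le en_pos[of i] by (intro mult_right_mono) auto
      moreover have "(1 + 10000 * e) * ((1 - e) * n i) = n i + 9999 * (e * n i) - 10000 * (e * (e * n i))"
        by (simp add: algebra_simps)
      ultimately have ly: "l y \<le> - n i - 9000 * (e * n i)" using * en_pos[of i] by linarith
      obtain g where g: "g \<in> int_points" "det3 g (x i) (x (Suc i)) \<noteq> 0"
        "\<bar>det3 g (x i) (x (Suc i))\<bar> \<le> exp (B + 2000 * (e * n i))"
        using B[of i] i(1) by (auto simp: J_def)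
      have "l y \<le> - (1 - e) * h y"
        using small_point_is_member[OF y(1) g _ ly] y(2) i J[OF i(1)] by auto
      then show ?thesis using y ly' by blast
    qed
  qed
qed

end

section \<open>Choice of the parameters\<close>

context dense_good_points
begin

lemma sqrt3_gap: "\<exists>s. 1 / \<nu> < s \<and> s\<^sup>2 < 3"
proof -
  have "(1 / \<nu>)\<^sup>2 < 3" using nu_gt nu_pos by (simp add: power_divide divide_less_eq)
  then have "1 / \<nu> < sqrt 3" using nu_pos by (simp add: real_less_rsqrt)
  then obtain s where s: "1 / \<nu> < s" "s < sqrt 3" using dense by blast
  have "0 < s" using s(1) nu_pos by (meson less_trans zero_less_divide_1_iff)
  then have "s\<^sup>2 < (sqrt 3)\<^sup>2" using s(2) by (intro power_strict_mono) auto
  then show ?thesis using s(1) by auto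
qed

text \<open>Good points of any level have the same uniform exponent as all integer points: \<open>e\<close> is chosen
after \<open>\<omega>\<close>, \<open>\<omega>'\<close> and \<open>\<epsilon>\<close>, and the thresholds after \<open>e\<close>.\<close>

lemma uniform_transfer:
  assumes ev: "\<forall>\<^sub>F t in at_top. \<exists>y \<in> int_points. h y \<le> t \<and> l y \<le> - \<omega> * t"
    and \<omega>: "0 < \<omega>'" "\<omega>' < \<omega>" and \<epsilon>: "0 < \<epsilon>"
  shows "\<forall>\<^sub>F t in at_top. \<exists>w \<in> int_points. h w \<le> t \<and> l w \<le> - \<omega>' * t \<and> l w \<le> - (1 - \<epsilon>) * h w"
proof -
  obtain s where s: "1 / \<nu> < s" "s\<^sup>2 < 3" using sqrt3_gap by blast
  obtain \<sigma> where \<sigma>: "1 / \<nu> < \<sigma>" "\<sigma> < s" using dense[OF s(1)] by blast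
  have \<nu>\<sigma>: "1 < \<nu> * \<sigma>" using \<sigma>(1) nu_pos by (simp add: divide_less_eq mult.commute)
  define e where "e = Min {\<epsilon>, 1/1000000, (3 - s\<^sup>2) / 1000000, (\<nu> * \<sigma> - 1) / 1000,
    (s - \<sigma>) / 1000, (\<omega> - \<omega>') / (10000 * \<omega>')}"
  have e_pos: "0 < e" unfolding e_def using \<epsilon> s \<sigma> \<nu>\<sigma> \<omega> by auto
  have e_bounds: "e \<le> \<epsilon>" "e \<le> 1/1000000" "e \<le> (3 - s\<^sup>2) / 1000000" "e \<le> (\<nu> * \<sigma> - 1) / 1000"
    "e \<le> (s - \<sigma>) / 1000" "e \<le> (\<omega> - \<omega>') / (10000 * \<omega>')"
    unfolding e_def by (intro Min_le; simp)+
  obtain M1 where M1: "\<And>x. x \<in> int_points \<Longrightarrow> l x \<le> - M1 \<Longrightarrow> l x \<le> - h x / 2 \<Longrightarrow> qdet x \<noteq> 0"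
    using qdet_nonzero by blast
  obtain t0 where t0: "\<And>t. t0 \<le> t \<Longrightarrow> \<exists>x \<in> int_points.
      h x \<le> t \<and> l x \<le> - \<nu> * t \<and> l x \<le> - (1 - e) * h x"
    using good_points[OF e_pos] unfolding eventually_at_top_linorder by blast
  define M where "M = Max {2 * M1, c / e, t0, 1}"
  have M: "2 * M1 \<le> M" "c / e \<le> M" "t0 \<le> M" "1 \<le> M" by (simp_all add: M_def)
  interpret scale \<xi> k \<nu> s \<sigma> e M
  proof unfold_locales
    show "c \<le> e * M" using M(2) e_pos by (simp add: divide_le_eq mult.commute)
    show "qdet x \<noteq> 0" if "x \<in> int_points" "l x \<le> - M / 2" "l x \<le> - h x / 2" for x
      using M1[OF that(1) _ that(3)] that(2) M(1) by simp
    show "\<exists>x\<in>int_points. h x \<le> t \<and> l x \<le> - \<nu> * t \<and> l x \<le> - (1 - e) * h x" if "M \<le> t" for t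
      using t0 that M(3) by simp
  qed (use e_pos e_bounds M in \<open>simp_all add: field_simps\<close>)
  have "\<exists>X. \<forall>j. (good e (X j) \<and> 100 * M \<le> h (X j)) \<and>
      (h (X (Suc j)) \<le> \<sigma> * h (X j) \<and> (1 + 900 * e) * h (X j) \<le> h (X (Suc j)))"
  proof (rule dependent_nat_choice)
    obtain x where "good e x" "(1 + 900 * e) * (100 * M) \<le> h x"
      using next_good[of "100 * M"] M_pos by auto
    moreover have "100 * M \<le> (1 + 900 * e) * (100 * M)" using e_pos M_pos by simp
    ultimately show "\<exists>x. good e x \<and> 100 * M \<le> h x" by fastforce
  next
    fix x and j :: nat
    assume x: "good e x \<and> 100 * M \<le> h x"
    then obtain y where y: "good e y" "h y \<le> \<sigma> * h x" "(1 + 900 * e) * h x \<le> h y"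
      using next_good[of "h x"] good_M by blast
    moreover have "1 * h x \<le> (1 + 900 * e) * h x"
      using e_pos good_pos[of e x] x by (intro mult_right_mono) auto
    ultimately show "\<exists>y. (good e y \<and> 100 * M \<le> h y) \<and> h y \<le> \<sigma> * h x \<and> (1 + 900 * e) * h x \<le> h y"
      using x by (intro exI[of _ y]) auto
  qed
  then obtain X where X: "\<And>j. good e (X j)" "\<And>j. 100 * M \<le> h (X j)"
    "\<And>j. h (X (Suc j)) \<le> \<sigma> * h (X j)" "\<And>j. (1 + 900 * e) * h (X j) \<le> h (X (Suc j))"
    by blast
  interpret chain \<xi> k \<nu> s \<sigma> e M X
    by unfold_locales (use X in auto)
  have "\<omega>' * (1 + 10000 * e) \<le> \<omega>"
    using e_bounds(6) \<omega> by (simp add: field_simps)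
  from transfer[OF \<omega>(1) this] ev
  have "\<forall>\<^sub>F t in at_top. \<exists>w \<in> int_points. h w \<le> t \<and> l w \<le> - \<omega>' * t \<and> l w \<le> - (1 - e) * h w"
    by (rule eventually_elim2) blast
  then show ?thesis
  proof (rule eventually_mono)
    fix t
    assume "\<exists>w \<in> int_points. h w \<le> t \<and> l w \<le> - \<omega>' * t \<and> l w \<le> - (1 - e) * h w"
    then obtain w where w: "w \<in> int_points" "h w \<le> t" "l w \<le> - \<omega>' * t" "l w \<le> - (1 - e) * h w" by blast
    have "(1 - \<epsilon>) * h w \<le> (1 - e) * h w"
      using e_bounds(1) h_nonneg[OF w(1)] by (intro mult_right_mono) auto
    then have "l w \<le> - (1 - \<epsilon>) * h w" using w(4) by (simp add: algebra_simps)
    then show "\<exists>w \<in> int_points. h w \<le> t \<and> l w \<le> - \<omega>' * t \<and> l w \<le> - (1 - \<epsilon>) * h w"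
      using w by blast
  qed
qed

text \<open>A nonzero integral determinant forces \<open>L x\<close> to be at least of order \<open>1 / N x\<close>.\<close>

lemma no_better_than_1:
  assumes "1 < \<omega>"
  shows "\<forall>\<^sub>F t in at_top. \<not> (\<exists>x \<in> int_points. h x \<le> t \<and> l x \<le> - \<omega> * t)"
proof -
  obtain M where M: "\<And>x. x \<in> int_points \<Longrightarrow> l x \<le> - M \<Longrightarrow> l x \<le> - h x / 2 \<Longrightarrow> qdet x \<noteq> 0"
    using qdet_nonzero by blast
  show ?thesis unfolding eventually_at_top_linorder
  proof (intro exI[of _ "Max {M, c / (\<omega> - 1) + 1, 0}"] allI impI notI)
    fix t
    assume "Max {M, c / (\<omega> - 1) + 1, 0} \<le> t"
    then have t: "M \<le> t" "c / (\<omega> - 1) < t" "0 \<le> t" by auto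
    assume "\<exists>x \<in> int_points. h x \<le> t \<and> l x \<le> - \<omega> * t"
    then obtain x where x: "x \<in> int_points" "h x \<le> t" "l x \<le> - \<omega> * t" by blast
    have "1 * t \<le> \<omega> * t" using assms t(3) by (intro mult_right_mono) auto
    then have "l x \<le> - t" using x(3) by simp
    then have "qdet x \<noteq> 0" using x t h_nonneg[OF x(1)] by (intro M) auto
    then have "0 \<le> c + h x + l x" by (rule qdet_log[OF x(1)])
    then have "\<omega> * t \<le> c + t" using x by simp
    moreover have "c < t * (\<omega> - 1)" using t(2) assms by (simp add: divide_less_eq)
    ultimately show False by (simp add: algebra_simps)
  qed
qed

end

section \<open>The exponents\<close>

text \<open>A relation with nonzero \<open>\<xi>\<^sup>2\<close> coefficient gives a quadratic polynomial, which is irreducible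
because a factor of degree one would have the irrational root \<open>\<xi>\<close>.\<close>

lemma linear_independence:
  assumes irr: "\<xi> \<notin> \<rat>" and nq: "\<not> quadratic_number \<xi>" and a: "a \<in> int_points"
  shows "a \<bullet> Xi_point \<xi> \<noteq> 0"
proof
  assume "a \<bullet> Xi_point \<xi> = 0"
  then have z0: "a$1 + a$2 * \<xi> + a$3 * \<xi>\<^sup>2 = 0"
    by (simp add: inner_vec_def sum_3 Xi_point_def)
  obtain p q r :: int where pqr: "a$1 = p" "a$2 = q" "a$3 = r"
    using int_points_D[OF a] by (metis Ints_cases)
  have z: "p + q * \<xi> + r * \<xi>\<^sup>2 = 0" using z0 pqr by simp
  have root: "v = 0" if "of_rat u + of_rat v * \<xi> = 0" for u v :: rat
  proof (rule ccontr)
    assume "v \<noteq> 0"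
    then have "\<xi> = of_rat (- u / v)"
      using that by (simp add: of_rat_divide of_rat_minus field_simps add_eq_0_iff)
    then show False using irr by simp
  qed
  show False
  proof (cases "r = 0")
    case True
    have "of_rat (of_int p) + of_rat (of_int q) * \<xi> = 0" using z True by simp
    then have "(of_int q :: rat) = 0" by (rule root)
    then have "q = 0" by simp
    then have "p = 0" using z True by simp
    then have "a = 0" using \<open>q = 0\<close> True pqr by (simp add: vec_eq_iff forall_3)
    then show False using a by (simp add: int_points_def)
  next
    case False
    define P :: "rat poly" where "P = [: of_int p, of_int q, of_int r :]"
    have deg: "degree P = 2" using False by (simp add: P_def)
    have "poly (map_poly of_rat P) \<xi> = 0"
      using z by (simp add: P_def map_poly_pCons algebra_simps power2_eq_square)
    moreover have "irreducible P"
    proof (rule irreducibleI)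
      show "P \<noteq> 0" using deg by auto
      then show "\<not> P dvd 1" using deg by (simp add: is_unit_iff_degree)
      fix A B assume AB: "P = A * B"
      have nz: "A \<noteq> 0" "B \<noteq> 0" using AB \<open>P \<noteq> 0\<close> by auto
      have dAB: "degree A + degree B = 2" using AB deg nz by (simp add: degree_mult_eq)
      have "\<not> (degree A = 1 \<and> degree B = 1)"
      proof
        assume d: "degree A = 1 \<and> degree B = 1"
        have linear: "Q = [: coeff Q 0, coeff Q 1 :] \<and> coeff Q 1 \<noteq> 0"
          if "degree Q = 1" for Q :: "rat poly"
          using that by (auto simp: poly_eq_iff coeff_pCons coeff_eq_0 split: nat.splits)
            (metis leading_coeff_0_iff degree_0 One_nat_def zero_neq_one)
        obtain a0 a1 where A: "A = [: a0, a1 :]" "a1 \<noteq> 0" using d linear by blast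
        obtain b0 b1 where B: "B = [: b0, b1 :]" "b1 \<noteq> 0" using d linear by blast
        have "of_int p = a0 * b0" "of_int q = a0 * b1 + a1 * b0" "of_int r = a1 * b1"
          using AB A B by (auto simp: P_def algebra_simps)
        then have "real_of_int p = of_rat (a0 * b0)" "real_of_int q = of_rat (a0 * b1 + a1 * b0)"
          "real_of_int r = of_rat (a1 * b1)"
          by (metis of_rat_of_int_eq)+
        then have "(of_rat a0 + of_rat a1 * \<xi>) * (of_rat b0 + of_rat b1 * \<xi>) = 0"
          using z by (simp add: of_rat_mult of_rat_add algebra_simps power2_eq_square)
        then show False using root A B by auto
      qed
      then have "degree A = 0 \<or> degree B = 0" using dAB by linarith
      then show "A dvd 1 \<or> B dvd 1" using nz by (auto simp: is_unit_iff_degree)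
    qed
    ultimately show False using nq deg unfolding quadratic_number_def by blast
  qed
qed

context independent_point
begin

lemma le_powr_iff:
  assumes "x \<in> int_points" "0 < X"
  shows "L x \<le> X powr (- b) \<longleftrightarrow> l x \<le> - b * ln X"
proof -
  have "L x \<le> X powr (- b) \<longleftrightarrow> l x \<le> ln (X powr (- b))"
    unfolding l_def using assms err_pos by (subst ln_le_cancel_iff) auto
  then show ?thesis using assms by (simp add: ln_powr)
qed

lemma infnorm_le_iff:
  assumes "x \<in> int_points" "0 < X" shows "infnorm x \<le> X \<longleftrightarrow> h x \<le> ln X"
  unfolding h_def using assms infnorm_pos by simp

lemma eventually_ln_iff: "(\<forall>\<^sub>F X in at_top. P (ln X)) \<longleftrightarrow> (\<forall>\<^sub>F t in at_top. P (t :: real))"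
  by (subst (2) filtermap_ln_at_top[symmetric]) (simp add: eventually_filtermap)

lemma eventually_approx_iff:
  "(\<forall>\<^sub>F X in at_top. \<exists>x \<in> int_points. infnorm (cross3 x (Xi_point \<xi>)) \<le> X powr (- b) \<and> infnorm x \<le> X)
   \<longleftrightarrow> (\<forall>\<^sub>F t in at_top. \<exists>x \<in> int_points. h x \<le> t \<and> l x \<le> - b * t)"
proof -
  have "(\<forall>\<^sub>F X in at_top. \<exists>x \<in> int_points. infnorm (cross3 x (Xi_point \<xi>)) \<le> X powr (- b) \<and> infnorm x \<le> X)
    \<longleftrightarrow> (\<forall>\<^sub>F X in at_top. \<exists>x \<in> int_points. h x \<le> ln X \<and> l x \<le> - b * ln X)"
    unfolding err_def[symmetric]
    by (rule eventually_subst, rule eventually_mono[OF eventually_gt_at_top[of 0]])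
      (auto simp: le_powr_iff infnorm_le_iff)
  also have "\<dots> \<longleftrightarrow> (\<forall>\<^sub>F t in at_top. \<exists>x \<in> int_points. h x \<le> t \<and> l x \<le> - b * t)"
    by (rule eventually_ln_iff)
  finally show ?thesis .
qed

lemma frequently_approx_iff:
  "(\<exists>\<^sub>F X in at_top. \<exists>x \<in> int_points. infnorm (cross3 x (Xi_point \<xi>)) \<le> X powr (- b) \<and> infnorm x \<le> X)
   \<longleftrightarrow> (\<exists>\<^sub>F t in at_top. \<exists>x \<in> int_points. h x \<le> t \<and> l x \<le> - b * t)"
proof -
  have "(\<forall>\<^sub>F X in at_top. \<not> (\<exists>x \<in> int_points. infnorm (cross3 x (Xi_point \<xi>)) \<le> X powr (- b) \<and> infnorm x \<le> X))
    \<longleftrightarrow> (\<forall>\<^sub>F X in at_top. \<not> (\<exists>x \<in> int_points. h x \<le> ln X \<and> l x \<le> - b * ln X))"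
    unfolding err_def[symmetric]
    by (rule eventually_subst, rule eventually_mono[OF eventually_gt_at_top[of 0]])
      (auto simp: le_powr_iff infnorm_le_iff)
  also have "\<dots> \<longleftrightarrow> (\<forall>\<^sub>F t in at_top. \<not> (\<exists>x \<in> int_points. h x \<le> t \<and> l x \<le> - b * t))"
    by (rule eventually_ln_iff)
  finally show ?thesis unfolding frequently_def by simp
qed

lemma eventually_approx_mu_iff:
  "(\<forall>\<^sub>F X in at_top. \<exists>x \<in> int_points. infnorm (cross3 x (Xi_point \<xi>)) \<le> min (X powr (- b)) (infnorm x powr (- \<mu>))
       \<and> infnorm x \<le> X)
   \<longleftrightarrow> (\<forall>\<^sub>F t in at_top. \<exists>x \<in> int_points. h x \<le> t \<and> l x \<le> - b * t \<and> l x \<le> - \<mu> * h x)"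
proof -
  have "L x \<le> infnorm x powr (- \<mu>) \<longleftrightarrow> l x \<le> - \<mu> * h x" if "x \<in> int_points" for x
    using le_powr_iff[OF that infnorm_pos[OF that]] by (simp add: h_def)
  then have "(\<forall>\<^sub>F X in at_top. \<exists>x \<in> int_points. infnorm (cross3 x (Xi_point \<xi>)) \<le> min (X powr (- b)) (infnorm x powr (- \<mu>))
       \<and> infnorm x \<le> X)
    \<longleftrightarrow> (\<forall>\<^sub>F X in at_top. \<exists>x \<in> int_points. h x \<le> ln X \<and> l x \<le> - b * ln X \<and> l x \<le> - \<mu> * h x)"
    unfolding err_def[symmetric] min.bounded_iff
    by (intro eventually_subst eventually_mono[OF eventually_gt_at_top[of 0]])
      (auto simp: le_powr_iff infnorm_le_iff)
  also have "\<dots> \<longleftrightarrow> (\<forall>\<^sub>F t in at_top. \<exists>x \<in> int_points. h x \<le> t \<and> l x \<le> - b * t \<and> l x \<le> - \<mu> * h x)"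
    by (rule eventually_ln_iff)
  finally show ?thesis .
qed

definition approximable :: "real \<Rightarrow> bool" where
  "approximable b \<longleftrightarrow> (\<forall>\<^sub>F t in at_top. \<exists>x \<in> int_points. h x \<le> t \<and> l x \<le> - b * t)"

definition approximable_mu :: "real \<Rightarrow> real \<Rightarrow> bool" where
  "approximable_mu \<mu> b \<longleftrightarrow> (\<forall>\<^sub>F t in at_top. \<exists>x \<in> int_points. h x \<le> t \<and> l x \<le> - b * t \<and> l x \<le> - \<mu> * h x)"

lemma lambda2_hat_eq: "lambda2_hat \<xi> = Sup (ereal ` Collect approximable)"
  unfolding lambda2_hat_def eventually_approx_iff approximable_def ..

lemma lambda_hat_mu_eq: "lambda_hat_mu \<mu> (Xi_point \<xi>) = Sup (ereal ` Collect (approximable_mu \<mu>))"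
  unfolding lambda_hat_mu_def eventually_approx_mu_iff approximable_mu_def ..

lemma lambda2_eq: "lambda2 \<xi> = Sup (ereal ` {b. \<exists>\<^sub>F t in at_top. \<exists>x \<in> int_points. h x \<le> t \<and> l x \<le> - b * t})"
  unfolding lambda2_def frequently_approx_iff ..

lemma approximable_mu_imp: "approximable_mu \<mu> b \<Longrightarrow> approximable b"
  unfolding approximable_def approximable_mu_def by (rule eventually_mono) blast+

lemma approximable_mu_mono:
  assumes "approximable_mu \<mu> b" "\<mu>' \<le> \<mu>" "b' \<le> b"
  shows "approximable_mu \<mu>' b'"
  unfolding approximable_mu_def
proof (rule eventually_mono[OF eventually_conj[OF assms(1)[unfolded approximable_mu_def] eventually_ge_at_top[of 0]]])
  fix t :: real
  assume "(\<exists>x \<in> int_points. h x \<le> t \<and> l x \<le> - b * t \<and> l x \<le> - \<mu> * h x) \<and> 0 \<le> t"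
  then obtain x where x: "x \<in> int_points" "h x \<le> t" "l x \<le> - b * t" "l x \<le> - \<mu> * h x" and t: "0 \<le> t" by blast
  have "b' * t \<le> b * t" "\<mu>' * h x \<le> \<mu> * h x"
    using assms t h_nonneg[OF x(1)] by (intro mult_right_mono; simp)+
  then have "l x \<le> - b' * t" "l x \<le> - \<mu>' * h x" using x by auto
  then show "\<exists>x \<in> int_points. h x \<le> t \<and> l x \<le> - b' * t \<and> l x \<le> - \<mu>' * h x" using x by blast
qed

lemma lambda_hat_mu_antimono:
  "\<mu>' \<le> \<mu> \<Longrightarrow> lambda_hat_mu \<mu> (Xi_point \<xi>) \<le> lambda_hat_mu \<mu>' (Xi_point \<xi>)"
  unfolding lambda_hat_mu_eq using approximable_mu_mono by (intro Sup_subset_mono image_mono) auto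

lemma lambda_hat_mu_le: "lambda_hat_mu \<mu> (Xi_point \<xi>) \<le> lambda2_hat \<xi>"
  unfolding lambda_hat_mu_eq lambda2_hat_eq using approximable_mu_imp by (intro Sup_subset_mono image_mono) auto

text \<open>As \<open>\<mu> < 1 \<le> \<lambda>\<^sub>2\<close>, there is an integer point \<open>x\<close> with \<open>L x \<le> N x powr (-\<mu>)\<close>. This single point
serves for every negative exponent.\<close>

lemma lambda_hat_mu_nonneg:
  assumes "1 \<le> lambda2 \<xi>" "0 \<le> \<mu>" "\<mu> < 1"
  shows "0 \<le> lambda_hat_mu \<mu> (Xi_point \<xi>)"
proof -
  have "ereal \<mu> < lambda2 \<xi>" using assms(1,3) by (metis ereal_less(3) less_le_trans one_ereal_def ereal_less_eq(3) not_le)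
  then obtain b where b: "\<mu> < b" "\<exists>\<^sub>F t in at_top. \<exists>x \<in> int_points. h x \<le> t \<and> l x \<le> - b * t"
    unfolding lambda2_eq less_Sup_iff by auto
  from frequently_eventually_frequently[OF b(2) eventually_ge_at_top[of 0]]
  obtain t x where x: "0 \<le> t" "x \<in> int_points" "h x \<le> t" "l x \<le> - b * t"
    by (auto dest!: frequently_ex)
  have "\<mu> * h x \<le> b * t" using b(1) assms(2) x h_nonneg[OF x(2)] by (intro mult_mono) auto
  then have lx: "l x \<le> - \<mu> * h x" using x(4) by simp
  have "approximable_mu \<mu> b'" if "b' < 0" for b'
    unfolding approximable_mu_def
  proof (rule eventually_mono[OF eventually_ge_at_top[of "max (h x) (l x / - b')"]])
    fix t assume "max (h x) (l x / - b') \<le> t"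
    then have "h x \<le> t" "l x \<le> - b' * t" using that by (auto simp: field_simps)
    then show "\<exists>x \<in> int_points. h x \<le> t \<and> l x \<le> - b' * t \<and> l x \<le> - \<mu> * h x"
      using lx x(2) by blast
  qed
  then have up: "ereal b' \<le> lambda_hat_mu \<mu> (Xi_point \<xi>)" if "b' < 0" for b'
    unfolding lambda_hat_mu_eq using that by (intro Sup_upper) auto
  show ?thesis
  proof (rule dense_le)
    fix y :: ereal assume "y < 0"
    then show "y \<le> lambda_hat_mu \<mu> (Xi_point \<xi>)" using up by (cases y) auto
  qed
qed

text \<open>The function under the limit is monotone, so the limit in the definition exists and is the
supremum of the values.\<close>

lemma beta0_ge:
  assumes "1 \<le> lambda2 \<xi>" "0 \<le> \<mu>" "\<mu> < 1"
  shows "1 / lambda_hat_mu \<mu> (Xi_point \<xi>) \<le> beta0 \<xi>"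
proof -
  let ?f = "\<lambda>\<mu>. 1 / lambda_hat_mu \<mu> (Xi_point \<xi>)"
  have mono: "?f a \<le> ?f b" if "0 \<le> a" "a \<le> b" "b < 1" for a b
    unfolding divide_ereal_def using that assms(1)
    by (simp add: ereal_inverse_antimono lambda_hat_mu_antimono lambda_hat_mu_nonneg)
  let ?S = "SUP \<mu> \<in> {0..<1}. ?f \<mu>"
  have "(?f \<longlongrightarrow> ?S) (at_left 1)"
  proof (rule order_tendstoI)
    fix a assume "a < ?S"
    then obtain m where m: "0 \<le> m" "m < 1" "a < ?f m" unfolding less_SUP_iff by auto
    then have "a < ?f y" if "m < y" "y < 1" for y
      using mono[of m y] that by (auto intro: less_le_trans)
    then show "\<forall>\<^sub>F y in at_left 1. a < ?f y"
      unfolding eventually_at_left[OF m(2)] using m(2) by blast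
  next
    fix a assume a: "?S < a"
    have "?f y < a" if "0 < y" "y < 1" for y
      using that by (intro le_less_trans[OF SUP_upper a]) auto
    then show "\<forall>\<^sub>F y in at_left 1. ?f y < a"
      unfolding eventually_at_left[OF zero_less_one] by (intro exI[of _ 0]) auto
  qed
  then have "beta0 \<xi> = ?S"
    unfolding beta0_def using assms(1) by (simp add: tendsto_Lim)
  then show ?thesis using assms by (auto intro: SUP_upper)
qed

end

theorem theorem1p8:
  fixes \<xi> :: real
  assumes "\<xi> \<notin> \<rat>" and "\<not> quadratic_number \<xi>"
    and "beta0 \<xi> < ereal (sqrt 3)"
  shows "lambda2_hat \<xi> = lambda_hat_min \<xi> \<and> lambda_hat_min \<xi> = 1 / beta0 \<xi>"
proof -
  interpret independent_point \<xi> "1 + \<bar>\<xi>\<bar>"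
    by unfold_locales (use linear_independence assms in auto)
  let ?f = "\<lambda>\<mu>. lambda_hat_mu \<mu> (Xi_point \<xi>)"
  have lam1: "1 \<le> lambda2 \<xi>"
    using assms(3) unfolding beta0_def by (auto split: if_splits)
  obtain \<beta> where \<beta>: "beta0 \<xi> < ereal \<beta>" "\<beta> < sqrt 3"
    using ereal_dense2[OF assms(3)] by auto
  have pos: "1 / ?f \<mu> < ereal \<beta>" "0 \<le> ?f \<mu>" if "0 \<le> \<mu>" "\<mu> < 1" for \<mu>
    using beta0_ge[OF lam1 that] \<beta>(1) lambda_hat_mu_nonneg[OF lam1 that] by auto
  have \<beta>pos: "0 < \<beta>"
  proof -
    have "0 \<le> 1 / ?f 0" using pos(2)[of 0] unfolding divide_ereal_def by (simp add: ereal_inverse_nonneg_iff)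
    from le_less_trans[OF this pos(1)[of 0]] show ?thesis by simp
  qed
  have f_gt: "ereal (1 / \<beta>) < ?f \<mu>" if "0 \<le> \<mu>" "\<mu> < 1" for \<mu>
    using pos[OF that] \<beta>pos by (cases "?f \<mu>") (auto simp: field_simps divide_ereal_def split: if_splits)
  have sqrt3: "1 / sqrt 3 < 1 / \<beta>" using \<beta>(2) \<beta>pos by (simp add: divide_strict_left_mono)
  have sqrt3': "1 / sqrt 3 < 58/100"
  proof -
    have "100/58 < sqrt 3" by (rule real_less_rsqrt) (simp add: power2_eq_square)
    then show ?thesis by (simp add: field_simps)
  qed
  obtain \<nu> where \<nu>: "1 / sqrt 3 < \<nu>" "\<nu> < min (1 / \<beta>) (58/100)"
    using dense[of "1 / sqrt 3" "min (1 / \<beta>) (58/100)"] sqrt3 sqrt3' by auto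
  have \<nu>0: "0 < \<nu>" using \<nu>(1) by (meson less_trans zero_less_divide_1_iff real_sqrt_gt_zero zero_less_numeral)
  have approximable_\<nu>: "approximable_mu \<mu> \<nu>" if "0 \<le> \<mu>" "\<mu> < 1" for \<mu>
  proof -
    have "ereal \<nu> < ?f \<mu>" using f_gt[OF that] \<nu>(2) by (auto intro: less_trans[rotated])
    then obtain b where "\<nu> < b" "approximable_mu \<mu> b" unfolding lambda_hat_mu_eq less_Sup_iff by auto
    then show ?thesis using approximable_mu_mono by auto
  qed
  interpret dense_good_points \<xi> "1 + \<bar>\<xi>\<bar>" \<nu>
  proof unfold_locales
    show "0 < \<nu>" "\<nu> < 58/100" using \<nu>0 \<nu>(2) by auto
    have "(1 / sqrt 3)\<^sup>2 < \<nu>\<^sup>2" using \<nu>(1) by (intro power_strict_mono) auto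
    then show "1 < 3 * \<nu>\<^sup>2" by (simp add: power_divide)
    fix e :: real assume "0 < e"
    then have "approximable_mu (max 0 (1 - e)) \<nu>" by (intro approximable_\<nu>) auto
    then have "approximable_mu (1 - e) \<nu>" by (rule approximable_mu_mono) auto
    then show "\<forall>\<^sub>F t in at_top. \<exists>x \<in> int_points. h x \<le> t \<and> l x \<le> - \<nu> * t \<and> l x \<le> - (1 - e) * h x"
      unfolding approximable_mu_def .
  qed
  have "lambda2 \<xi> \<le> 1"
    unfolding lambda2_eq
  proof (rule Sup_least)
    fix y assume "y \<in> ereal ` {b. \<exists>\<^sub>F t in at_top. \<exists>x \<in> int_points. h x \<le> t \<and> l x \<le> - b * t}"
    then obtain b where "y = ereal b" "\<exists>\<^sub>F t in at_top. \<exists>x \<in> int_points. h x \<le> t \<and> l x \<le> - b * t" by blast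
    moreover from this have "\<not> 1 < b" using no_better_than_1[of b] unfolding frequently_def by blast
    ultimately show "y \<le> 1" by simp
  qed
  then have lam_eq: "lambda2 \<xi> = ereal 1" using lam1 by (simp add: one_ereal_def antisym)
  have f_eq: "?f \<mu> = lambda2_hat \<xi>" if \<mu>: "0 \<le> \<mu>" "\<mu> < 1" for \<mu>
  proof (rule antisym[OF lambda_hat_mu_le], unfold lambda2_hat_eq, rule Sup_least)
    fix y assume "y \<in> ereal ` Collect approximable"
    then obtain b where b: "y = ereal b" "approximable b" by blast
    show "y \<le> ?f \<mu>"
    proof (cases "0 < b")
      case False
      then have "y \<le> 0" using b by simp
      then show ?thesis using pos(2)[OF \<mu>] by (rule order_trans)
    next
      case True
      have up: "ereal b' \<le> ?f \<mu>" if "0 < b'" "b' < b" for b'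
      proof -
        have "approximable_mu (1 - (1 - \<mu>)) b'"
          unfolding approximable_mu_def using b(2) that \<mu> by (intro uniform_transfer[of b]) (auto simp: approximable_def)
        then show ?thesis unfolding lambda_hat_mu_eq by (intro Sup_upper) auto
      qed
      show ?thesis
      proof (rule dense_le_bounded[of 0])
        show "0 < y" using True b by simp
        fix w assume "0 < w" "w < y"
        then show "w \<le> ?f \<mu>" using up b(1) by (cases w) auto
      qed
    qed
  qed
  have ev: "\<forall>\<^sub>F \<mu> in at_left 1. ?f \<mu> = lambda2_hat \<xi>"
    unfolding eventually_at_left[OF zero_less_one] using f_eq by (intro exI[of _ 0]) auto
  have "((\<lambda>\<mu>. 1 / ?f \<mu>) \<longlongrightarrow> 1 / lambda2_hat \<xi>) (at_left 1)"
    by (rule tendsto_eventually) (rule eventually_mono[OF ev], simp)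
  then have beta: "beta0 \<xi> = 1 / lambda2_hat \<xi>"
    unfolding beta0_def using lam1 by (simp add: tendsto_Lim)
  have "(?f \<longlongrightarrow> lambda2_hat \<xi>) (at_left 1)"
    by (rule tendsto_eventually) (rule ev)
  then have "((?f \<circ> real_of_ereal) \<longlongrightarrow> lambda2_hat \<xi>) (at_left (ereal 1))"
    by (simp only: ereal_tendsto_simps)
  then have min: "lambda_hat_min \<xi> = lambda2_hat \<xi>"
    unfolding lambda_hat_min_def lam_eq
    by (intro tendsto_Lim) (auto simp: comp_def at_left_ereal filtermap_bot_iff)
  have "ereal (1 / \<beta>) < lambda2_hat \<xi>" using f_gt[of 0] f_eq[of 0] by simp
  then have "1 / beta0 \<xi> = lambda2_hat \<xi>"
    unfolding beta using \<beta>pos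
    by (cases "lambda2_hat \<xi>") (auto simp: divide_ereal_def dest: less_trans[rotated])
  with min show ?thesis by simp
qed

end
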